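(* Let $\Lambda\subset\mathbb{D}$ be a separated non-Blaschke sequence and $(\varepsilon_\lambda)_{\lambda\in\Lambda}$ a sequence of positive values. Then there exists a non-zero function $f\in H^\infty(\mathbb{D})$ with $|f(\lambda)|<\varepsilon_\lambda$ for all $\lambda\in\Lambda$ if and only if $\Lambda$ is the union of a Blaschke sequence and a sequence $\Gamma$ for which there exists a universal constant $C=C(\Gamma)$ such that $$\sum_{\gamma\in\Gamma}c_\gamma\log\varepsilon_\gamma^{-1}\le C\sup_{\zeta\in\partial\mathbb{D}}\sum_{\gamma\in\Gamma}c_\gamma P_\gamma(\zeta)$$ for any sequence of nonnegative numbers $(c_\gamma)_{\gamma\in\Gamma}$.
   Context: $\mathbb{D}$ is the open unit disc and $H^\infty(\mathbb{D})$ the space of bounded holomorphic functions on $\mathbb{D}$. A sequence $\Lambda\subset\mathbb{D}$ is separated if $\inf_{\lambda\ne\lambda'}\rho(\lambda,\lambda')>0$, where $\rho(z,w)=\left|\frac{z-w}{1-z\overline{w}}\right|$. A sequence $\Lambda$ is Blaschke if $\sum_{\lambda\in\Lambda}(1-|\lambda|)<\infty$, and non-Blaschke otherwise. $P_z(\zeta)=\frac{1-|z|^2}{|\zeta-z|^2}$ is the Poisson kernel. *)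

theory Defs
  imports "HOL-Complex_Analysis.Complex_Analysis"
begin

text \<open>
  Sequences in the disc are rendered as subsets of \<open>ball 0 1\<close>: the weights \<open>\<epsilon>\<close> are indexed by
  the points themselves, and a separated set is automatically countable.
\<close>

definition pseudohyp_dist :: "complex \<Rightarrow> complex \<Rightarrow> real" where
  "pseudohyp_dist z w = cmod ((z - w) / (1 - z * cnj w))"

text \<open>The infimum is taken in \<^typ>\<open>ereal\<close>, so sets with at most one point count as separated.\<close>

definition separated :: "complex set \<Rightarrow> bool" where
  "separated \<Lambda> \<longleftrightarrow> 0 < (INF z\<in>\<Lambda>. INF w\<in>\<Lambda> - {z}. ereal (pseudohyp_dist z w))"

definition blaschke :: "complex set \<Rightarrow> bool" where
  "blaschke \<Lambda> \<longleftrightarrow> \<Lambda> \<subseteq> ball 0 1 \<and> (\<lambda>z. 1 - cmod z) summable_on \<Lambda>"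

definition poisson_kernel :: "complex \<Rightarrow> complex \<Rightarrow> real" where
  "poisson_kernel z \<zeta> = (1 - (cmod z)\<^sup>2) / (cmod (\<zeta> - z))\<^sup>2"

definition H_infty :: "(complex \<Rightarrow> complex) set" where
  "H_infty = {f. f holomorphic_on ball 0 1 \<and> bounded (f ` ball 0 1)}"

text \<open>
  Both sums are unconditional sums in \<^typ>\<open>ereal\<close>. The one on the right has nonnegative terms, so
  it always exists, possibly with value \<open>\<infinity>\<close>. The one on the left may have terms of both signs, as
  \<open>\<epsilon> > 1\<close> is allowed. If its positive part is infinite, then the inequality for the family obtained
  from \<open>c\<close> by keeping only the terms with \<open>\<epsilon> \<gamma> < 1\<close> forces the right-hand side to be \<open>\<infinity>\<close>; so the
  default value 0 that \<^const>\<open>infsum\<close> takes on a sum of the form \<open>\<infinity> - \<infinity>\<close> has no effect. Since the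
  supremum is nonnegative, taking \<open>C > 0\<close> is no restriction; it only excludes the product \<open>0 * \<infinity>\<close>.
\<close>

definition poisson_dominated :: "(complex \<Rightarrow> real) \<Rightarrow> complex set \<Rightarrow> bool" where
  "poisson_dominated \<epsilon> \<Gamma> \<longleftrightarrow>
     (\<exists>C::real. C > 0 \<and>
       (\<forall>c :: complex \<Rightarrow> real. (\<forall>\<gamma>\<in>\<Gamma>. 0 \<le> c \<gamma>) \<longrightarrow>
         (\<Sum>\<^sub>\<infinity>\<gamma>\<in>\<Gamma>. ereal (c \<gamma> * ln (inverse (\<epsilon> \<gamma>))))
           \<le> ereal C * (SUP \<zeta>\<in>sphere 0 1. \<Sum>\<^sub>\<infinity>\<gamma>\<in>\<Gamma>. ereal (c \<gamma> * poisson_kernel \<gamma> \<zeta>))))"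

end

(*
  Necessity: for f with |f| <= 1, a point at distance less than \<kappa> (1 - |b|) from a zero of f
  is charged to that zero; separation makes this injective, so these points form a Blaschke
  sequence.  At the remaining points -log|f| is bounded by a multiple of a positive harmonic
  function h: the Blaschke factor with zero w contributes at most
  const * (1 - |w|^2) P_\<gamma>(w/|w|), and the zero-free quotient is handled by the Poisson formula.
  Pairing h with the weights c gives at most h(0) times the supremum of the Poisson sum.

  Sufficiency: the inequality is the dual form of the existence of a positive measure of mass C
  whose Poisson extension dominates log(1/\<epsilon>) on \<Gamma>.  No measures are needed: on a finite subset
  an approximate minimiser of the squared deficit over the convex set of the real parts of
  holomorphic H with H(0) = C and Re H >= 0 does it up to a bounded error, g = exp(-H) is then
  small on that subset, and Montel's theorem passes to \<Gamma>.
*)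
theory Submission
  imports Defs
begin

section \<open>Duality, Montel limits and Blaschke products\<close>

text \<open>A bounded \<open>f\<close> may have zeros accumulating at the circle and need not extend
  to it, so neither a full factorisation nor boundary values are used. Finitely many points of
  \<Gamma> are tested at a time, at the dilated points \<open>s * \<gamma>\<close> with s < 1. Then
  only the zeros in a smaller disc have to be divided out; there are finitely many, and the dilated
  quotient has a holomorphic logarithm up to the circle. The constants do not depend on s, on the
  number of zeros or on the finite set, so s may tend to 1. Since \<open>f\<close> may vanish at 0,
  its size is measured at some \<open>a\<close> with \<open>f a \<noteq> 0\<close>, and Harnack's
  inequality carries the bound from \<open>a\<close> to 0.

  In the converse, H(0) = C gives |g(0)| = exp(-C) for every finite subset; this keeps the Montel
  limit from being zero. A bounded error in Re H costs only a constant factor in g, removed by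
  rescaling at the end, so an approximate minimiser suffices and no minimum has to be attained. The
  Blaschke part is handled by a second factor that vanishes on it.\<close>

text \<open>
  Let \<open>x\<close> nearly minimise the squared deficit \<open>\<Sum> (max 0 (l - x))\<^sup>2\<close> over \<open>K\<close>. Its negative
  gradient \<open>c = max 0 (l - x)\<close> is an admissible weight, and moving from \<open>x\<close> towards a good
  response to \<open>c\<close> cannot decrease the deficit by much; this forces the deficit to be small.
\<close>

lemma convex_approx_minimax:
  fixes K :: "('a \<Rightarrow> real) set" and l M :: "'a \<Rightarrow> real"
  assumes fin: "finite F" and ne: "K \<noteq> {}"
    and conv: "\<And>x y t. x \<in> K \<Longrightarrow> y \<in> K \<Longrightarrow> 0 \<le> t \<Longrightarrow> t \<le> 1 \<Longrightarrow>
                 (\<lambda>i. (1 - t) * x i + t * y i) \<in> K"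
    and bdd: "\<And>x i. x \<in> K \<Longrightarrow> i \<in> F \<Longrightarrow> \<bar>x i\<bar> \<le> M i"
    and resp: "\<And>c \<eta>. (\<forall>i. 0 \<le> c i) \<Longrightarrow> 0 < \<eta> \<Longrightarrow>
                 \<exists>x\<in>K. (\<Sum>i\<in>F. c i * l i) \<le> (\<Sum>i\<in>F. c i * x i) + \<eta>"
    and \<delta>: "0 < \<delta>"
  shows "\<exists>x\<in>K. \<forall>i\<in>F. l i \<le> x i + \<delta>"
proof -
  define \<phi> where "\<phi> x = (\<Sum>i\<in>F. (max 0 (l i - x i))\<^sup>2)" for x
  define V where "V = (\<Sum>i\<in>F. (2 * M i)\<^sup>2)"
  have V0: "0 \<le> V"
    unfolding V_def by (intro sum_nonneg) auto
  \<comment> \<open>\<open>V\<close> bounds the squared distance of two points of \<open>K\<close>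
    on \<open>F\<close>. Moving an \<eta>^2-minimiser by the fraction \<eta> towards the response
    lowers the deficit by at most \<eta>^2, so the sum of \<open>c i * v i\<close> is at most \<eta>
    (1 + V) / 2. Adding the response error \<eta> gives \<eta> (3 + V) / 2.\<close>
  define \<eta> where "\<eta> = min 1 (2 * \<delta>\<^sup>2 / (3 + V))"
  have \<eta>: "0 < \<eta>" "\<eta> \<le> 1" "\<eta> * (3 + V) / 2 \<le> \<delta>\<^sup>2"
  proof -
    show "0 < \<eta>" "\<eta> \<le> 1"
      using V0 \<delta> by (auto simp: \<eta>_def)
    have "\<eta> \<le> 2 * \<delta>\<^sup>2 / (3 + V)"
      by (simp add: \<eta>_def)
    then show "\<eta> * (3 + V) / 2 \<le> \<delta>\<^sup>2"
      using V0 by (simp add: field_simps)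
  qed
  have bb: "bdd_below (\<phi> ` K)"
    by (rule bdd_belowI[of _ 0]) (auto simp: \<phi>_def intro!: sum_nonneg)
  define m where "m = Inf (\<phi> ` K)"
  have mle: "m \<le> \<phi> z" if "z \<in> K" for z
    unfolding m_def using bb that by (auto intro: cInf_lower)
  have "\<exists>x\<in>K. \<phi> x < m + \<eta>\<^sup>2"
  proof -
    have "Inf (\<phi> ` K) < m + \<eta>\<^sup>2"
      using \<eta>(1) by (simp add: m_def)
    then show ?thesis
      using cInf_lessD[of "\<phi> ` K"] ne by auto
  qed
  then obtain x where x: "x \<in> K" "\<phi> x < m + \<eta>\<^sup>2"
    by blast
  define c where "c i = max 0 (l i - x i)" for i
  have c0: "\<forall>i. 0 \<le> c i"
    by (simp add: c_def)
  obtain y where y: "y \<in> K" "(\<Sum>i\<in>F. c i * l i) \<le> (\<Sum>i\<in>F. c i * y i) + \<eta>"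
    using resp[OF c0 \<eta>(1)] by blast
  define v where "v i = y i - x i" for i
  define z where "z i = (1 - \<eta>) * x i + \<eta> * y i" for i
  have z: "z \<in> K"
    unfolding z_def using x(1) y(1) \<eta> by (intro conv) auto
  have "\<phi> z \<le> (\<Sum>i\<in>F. (c i - \<eta> * v i)\<^sup>2)"
    unfolding \<phi>_def
  proof (rule sum_mono)
    fix i
    have e: "l i - z i = (l i - x i) - \<eta> * v i"
      by (simp add: z_def v_def algebra_simps)
    have "l i - z i \<le> c i - \<eta> * v i"
      unfolding e c_def by simp
    then show "(max 0 (l i - z i))\<^sup>2 \<le> (c i - \<eta> * v i)\<^sup>2"
      by (cases "l i - z i \<le> 0") (simp_all add: max_def power_mono)
  qed
  also have "\<dots> = \<phi> x - 2 * \<eta> * (\<Sum>i\<in>F. c i * v i) + \<eta>\<^sup>2 * (\<Sum>i\<in>F. (v i)\<^sup>2)"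
    unfolding \<phi>_def c_def[symmetric] sum_distrib_left sum_subtractf[symmetric] sum.distrib[symmetric]
    by (intro sum.cong) (simp_all add: power2_eq_square algebra_simps)
  also have "\<dots> \<le> \<phi> x - 2 * \<eta> * (\<Sum>i\<in>F. c i * v i) + \<eta>\<^sup>2 * V"
  proof -
    have "(\<Sum>i\<in>F. (v i)\<^sup>2) \<le> V"
      unfolding V_def
    proof (rule sum_mono)
      fix i assume "i \<in> F"
      then have "\<bar>v i\<bar> \<le> 2 * M i"
        using bdd[OF x(1), of i] bdd[OF y(1), of i] by (simp add: v_def)
      then show "(v i)\<^sup>2 \<le> (2 * M i)\<^sup>2"
        by (metis abs_ge_zero power2_abs power_mono)
    qed
    then show ?thesis
      by (simp add: mult_left_mono)
  qed
  finally have "2 * \<eta> * (\<Sum>i\<in>F. c i * v i) \<le> \<eta>\<^sup>2 * (1 + V)"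
    using mle[OF z] x(2) by (simp add: algebra_simps)
  then have "\<eta> * (2 * (\<Sum>i\<in>F. c i * v i)) \<le> \<eta> * (\<eta> * (1 + V))"
    by (simp add: power2_eq_square algebra_simps)
  then have "2 * (\<Sum>i\<in>F. c i * v i) \<le> \<eta> * (1 + V)"
    using \<eta>(1) by (rule mult_left_le_imp_le)
  then have cv: "(\<Sum>i\<in>F. c i * v i) \<le> \<eta> * (1 + V) / 2"
    by linarith
  \<comment> \<open>As \<open>c\<close> vanishes where l \<le> x, each square equals
    \<open>c i * (l i - x i)\<close>; the deficit becomes linear in \<open>l\<close>, which brings
    in the response inequality.\<close>
  have "\<phi> x = (\<Sum>i\<in>F. c i * (l i - x i))"
    unfolding \<phi>_def by (intro sum.cong) (auto simp: c_def max_def power2_eq_square)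
  also have "\<dots> = (\<Sum>i\<in>F. c i * l i) - (\<Sum>i\<in>F. c i * y i) + (\<Sum>i\<in>F. c i * v i)"
    by (simp add: v_def algebra_simps sum_subtractf sum.distrib)
  also have "\<dots> \<le> \<eta> * (3 + V) / 2"
    using y(2) cv by (simp add: field_simps)
  also have "\<dots> \<le> \<delta>\<^sup>2"
    by (rule \<eta>)
  finally have \<phi>x: "\<phi> x \<le> \<delta>\<^sup>2" .
  have "l i \<le> x i + \<delta>" if "i \<in> F" for i
  proof -
    have "(c i)\<^sup>2 \<le> \<phi> x"
      unfolding \<phi>_def c_def using fin that
      by (intro member_le_sum[of i F "\<lambda>i. (max 0 (l i - x i))\<^sup>2"]) auto
    then have "(c i)\<^sup>2 \<le> \<delta>\<^sup>2"
      using \<phi>x by simp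
    then have "c i \<le> \<delta>"
      by (rule power2_le_imp_le) (use \<delta> in simp)
    then show ?thesis
      by (simp add: c_def)
  qed
  then show ?thesis
    using x(1) by blast
qed

text \<open>A normal family argument along an exhaustion of \<open>A\<close> by finite sets: each
  point belongs to all but finitely many of them. The lower bound at 0 passes to the limit, and for
  \<eta> > 0 it excludes the zero function.\<close>

lemma contractive_limit_of_finite_approx:
  fixes A :: "complex set" and t :: "complex \<Rightarrow> real"
  assumes A: "countable A" "A \<subseteq> ball 0 1"
    and approx: "\<And>F. finite F \<Longrightarrow> F \<subseteq> A \<Longrightarrow> \<exists>g. g holomorphic_on ball 0 1 \<and>
      (\<forall>z\<in>ball 0 1. cmod (g z) \<le> 1) \<and> \<eta> \<le> cmod (g 0) \<and> (\<forall>z\<in>F. cmod (g z) \<le> t z)"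
  shows "\<exists>g. g holomorphic_on ball 0 1 \<and>
      (\<forall>z\<in>ball 0 1. cmod (g z) \<le> 1) \<and> \<eta> \<le> cmod (g 0) \<and> (\<forall>z\<in>A. cmod (g z) \<le> t z)"
proof (cases "A = {}")
  case True
  then show ?thesis
    using approx[of "{}"] by auto
next
  case False
  define F where "F n = from_nat_into A ` {..n}" for n :: nat
  have "finite (F n)" "F n \<subseteq> A" for n
    using from_nat_into[OF False] by (auto simp: F_def)
  then have "\<exists>g. g holomorphic_on ball 0 1 \<and> (\<forall>z\<in>ball 0 1. cmod (g z) \<le> 1) \<and>
      \<eta> \<le> cmod (g 0) \<and> (\<forall>z\<in>F n. cmod (g z) \<le> t z)" for n
    by (intro approx)
  then obtain g where g: "\<And>n. g n holomorphic_on ball 0 1"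
    "\<And>n z. z \<in> ball 0 1 \<Longrightarrow> cmod (g n z) \<le> 1"
    "\<And>n. \<eta> \<le> cmod (g n 0)" "\<And>n z. z \<in> F n \<Longrightarrow> cmod (g n z) \<le> t z"
    by metis
  obtain h r where h: "h holomorphic_on ball 0 1" "strict_mono (r :: nat \<Rightarrow> nat)"
      "\<And>x. x \<in> ball 0 1 \<Longrightarrow> (\<lambda>n. g (r n) x) \<longlonglongrightarrow> h x"
    by (rule Montel[of "ball 0 1" "range g" g]) (use g in \<open>auto intro!: exI[of _ 1]\<close>)
  have lim: "(\<lambda>n. cmod (g (r n) x)) \<longlonglongrightarrow> cmod (h x)" if "x \<in> ball 0 1" for x
    using h(3)[OF that] by (rule tendsto_norm)
  have "cmod (h z) \<le> 1" if "z \<in> ball 0 1" for z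
    using LIMSEQ_le_const2[OF lim[OF that]] g(2)[OF that] by blast
  moreover have "\<eta> \<le> cmod (h 0)"
    using LIMSEQ_le_const[OF lim[of 0]] g(3) by auto
  moreover have "cmod (h z) \<le> t z" if z: "z \<in> A" for z
  proof -
    obtain k where k: "z = from_nat_into A k"
      by (metis A(1) from_nat_into_surj z)
    have "cmod (g (r n) z) \<le> t z" if "k \<le> n" for n
    proof -
      have "k \<le> r n"
        using that seq_suble[OF h(2), of n] by linarith
      then show ?thesis
        using k by (intro g(4)) (auto simp: F_def)
    qed
    then show ?thesis
      using z A(2) by (intro LIMSEQ_le_const2[OF lim[of z]]) auto
  qed
  ultimately show ?thesis
    using h(1) by blast
qed

section \<open>Bounded functions with prescribed zeros\<close>

lemma Moebius_function_0_eq_zero_iff: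
  assumes "cmod w < 1" "cmod z < 1"
  shows "Moebius_function 0 w z = 0 \<longleftrightarrow> z = w"
proof -
  have "cmod (cnj w * z) < 1"
    using norm_mult_less[of "cnj w" 1 z 1] assms by simp
  then have "1 - cnj w * z \<noteq> 0"
    by auto
  then show ?thesis
    by (simp add: Moebius_function_simple)
qed

text \<open>Applied to x = |w|, this bounds a Blaschke product at 0 from below in terms of the sum
  of 1 - |w| alone, however many factors there are.\<close>

lemma weierstrass_product_ineq:
  fixes x :: "'a \<Rightarrow> real"
  assumes "\<And>i. i \<in> F \<Longrightarrow> 0 \<le> x i" "\<And>i. i \<in> F \<Longrightarrow> x i \<le> 1"
  shows "1 - (\<Sum>i\<in>F. 1 - x i) \<le> (\<Prod>i\<in>F. x i)"
  using assms
proof (induction F rule: infinite_finite_induct)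
  case (insert a F)
  then have IH: "1 - (\<Sum>i\<in>F. 1 - x i) \<le> (\<Prod>i\<in>F. x i)"
    by simp
  have p: "(\<Prod>i\<in>F. x i) \<le> 1"
    by (intro prod_le_1) (use insert in auto)
  have "(1 - x a) * (\<Prod>i\<in>F. x i) \<le> (1 - x a) * 1"
    using insert p by (intro mult_left_mono) auto
  then show ?case
    using IH insert.hyps by (simp add: algebra_simps)
qed auto

lemma blaschke_small_tail:
  assumes "blaschke B" "0 < \<eta>"
  shows "\<exists>F. finite F \<and> F \<subseteq> B \<and>
    (\<forall>G. finite G \<longrightarrow> G \<subseteq> B - F \<longrightarrow> (\<Sum>z\<in>G. 1 - cmod z) \<le> \<eta>)"
proof -
  have B: "B \<subseteq> ball 0 1" "(\<lambda>z. 1 - cmod z) summable_on B"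
    using assms(1) by (auto simp: blaschke_def)
  obtain F where F: "finite F" "F \<subseteq> B"
      "dist (\<Sum>z\<in>F. 1 - cmod z) (infsum (\<lambda>z. 1 - cmod z) B) \<le> \<eta>"
    using has_sum_finite_approximation[OF has_sum_infsum[OF B(2)] assms(2)] by blast
  have "(\<Sum>z\<in>G. 1 - cmod z) \<le> \<eta>" if G: "finite G" "G \<subseteq> B - F" for G
  proof -
    have "(\<Sum>z\<in>F \<union> G. 1 - cmod z) \<le> infsum (\<lambda>z. 1 - cmod z) B"
      using B F G by (intro finite_sum_le_infsum) auto
    also have "(\<Sum>z\<in>F \<union> G. 1 - cmod z) = (\<Sum>z\<in>F. 1 - cmod z) + (\<Sum>z\<in>G. 1 - cmod z)"
      using F G by (intro sum.union_disjoint) auto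
    finally show ?thesis
      using F(3) by (simp add: dist_real_def)
  qed
  then show ?thesis
    using F by blast
qed

lemma blaschke_countable:
  assumes "blaschke B"
  shows "countable B"
proof -
  have "countable {z \<in> B. 1 - cmod z \<noteq> 0}"
    by (rule summable_countable_real) (use assms in \<open>auto simp: blaschke_def\<close>)
  also have "{z \<in> B. 1 - cmod z \<noteq> 0} = B"
    using assms by (auto simp: blaschke_def)
  finally show ?thesis .
qed

lemma finite_blaschke_product:
  assumes "finite F" "F \<subseteq> ball 0 1"
  defines "b \<equiv> \<lambda>z. \<Prod>w\<in>F. Moebius_function 0 w z"
  shows "b holomorphic_on ball 0 1" "\<And>z. z \<in> ball 0 1 \<Longrightarrow> cmod (b z) \<le> 1"
    "cmod (b 0) = (\<Prod>w\<in>F. cmod w)"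
    "\<And>z. z \<in> ball 0 1 \<Longrightarrow> b z = 0 \<longleftrightarrow> z \<in> F"
proof -
  show "b holomorphic_on ball 0 1"
    unfolding b_def using assms by (intro holomorphic_on_prod Moebius_function_holomorphic) auto
  show "cmod (b z) \<le> 1" if "z \<in> ball 0 1" for z
    unfolding b_def prod_norm[symmetric] using assms that
    by (intro prod_le_1) (auto intro!: less_imp_le[OF Moebius_function_norm_lt_1])
  show "cmod (b 0) = (\<Prod>w\<in>F. cmod w)"
    unfolding b_def prod_norm[symmetric] by (simp add: Moebius_function_simple)
  show "b z = 0 \<longleftrightarrow> z \<in> F" if "z \<in> ball 0 1" for z
    unfolding b_def prod_zero_iff[OF assms(1)]
    using assms that Moebius_function_0_eq_zero_iff[of _ z] by (metis mem_ball_0 subsetD)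
qed

text \<open>Finite products over a tail of total weight 1/2 have modulus at least 1/2 at 0, so they
  have a nonzero limit and no infinite product needs to be studied. The finitely many remaining
  points, possibly including 0, enter through a finite product.\<close>

lemma blaschke_zero_function:
  assumes "blaschke B"
  shows "\<exists>f. f holomorphic_on ball 0 1 \<and> (\<forall>z\<in>ball 0 1. cmod (f z) \<le> 1) \<and>
    (\<exists>z\<in>ball 0 1. f z \<noteq> 0) \<and> (\<forall>z\<in>B. f z = 0)"
proof -
  have B: "B \<subseteq> ball 0 1"
    using assms by (simp add: blaschke_def)
  obtain F where F: "finite F" "F \<subseteq> B"
    "\<And>G. finite G \<Longrightarrow> G \<subseteq> B - F \<Longrightarrow> (\<Sum>z\<in>G. 1 - cmod z) \<le> 1 / 2"
    using blaschke_small_tail[OF assms, of "1/2"] by auto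
  have "\<exists>g. g holomorphic_on ball 0 1 \<and> (\<forall>z\<in>ball 0 1. cmod (g z) \<le> 1) \<and>
      1 / 2 \<le> cmod (g 0) \<and> (\<forall>z\<in>B - F. cmod (g z) \<le> 0)"
  proof (rule contractive_limit_of_finite_approx)
    show "countable (B - F)"
      using blaschke_countable[OF assms] by blast
    show "B - F \<subseteq> ball 0 1"
      using B by blast
    fix G assume G: "finite G" "G \<subseteq> B - F"
    then have Gb: "G \<subseteq> ball 0 1"
      using B by blast
    note b = finite_blaschke_product[OF G(1) Gb]
    have "1 / 2 \<le> 1 - (\<Sum>w\<in>G. 1 - cmod w)"
      using F(3)[OF G] by simp
    also have "\<dots> \<le> (\<Prod>w\<in>G. cmod w)"
      by (rule weierstrass_product_ineq) (use Gb in \<open>auto simp: less_imp_le\<close>)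
    finally show "\<exists>g. g holomorphic_on ball 0 1 \<and> (\<forall>z\<in>ball 0 1. cmod (g z) \<le> 1) \<and>
        1 / 2 \<le> cmod (g 0) \<and> (\<forall>z\<in>G. cmod (g z) \<le> 0)"
      using b Gb by (intro exI[of _ "\<lambda>z. \<Prod>w\<in>G. Moebius_function 0 w z"]) auto
  qed
  then obtain g where g: "g holomorphic_on ball 0 1" "\<And>z. z \<in> ball 0 1 \<Longrightarrow> cmod (g z) \<le> 1"
    "1 / 2 \<le> cmod (g 0)" "\<And>z. z \<in> B - F \<Longrightarrow> g z = 0"
    by auto
  have "F \<subseteq> ball 0 1"
    using F B by blast
  note b = finite_blaschke_product[OF F(1) this]
  define b where "b z = (\<Prod>w\<in>F. Moebius_function 0 w z)" for z
  \<comment> \<open>\<open>g\<close> is nonzero on a neighbourhood of 0, hence on an infinite set,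
    which cannot lie inside the finite zero set of \<open>b\<close>.\<close>
  define U where "U = ball 0 1 \<inter> g -` (-{0})"
  have "open U"
    unfolding U_def using g(1)
    by (intro continuous_open_preimage holomorphic_on_imp_continuous_on) auto
  moreover have "0 \<in> U"
    using g(3) by (auto simp: U_def)
  ultimately have "infinite U"
    using finite_imp_not_open[of U] by auto
  then obtain z where z: "z \<in> U" "z \<notin> F"
    using F(1) finite_subset[of U F] by blast
  have "(\<lambda>z. b z * g z) holomorphic_on ball 0 1"
    using b(1) g(1) unfolding b_def by (rule holomorphic_on_mult)
  moreover have "cmod (b z * g z) \<le> 1" if "z \<in> ball 0 1" for z
    unfolding norm_mult using b(2)[OF that] g(2)[OF that]
    by (intro mult_le_one) (auto simp: b_def)
  moreover have "b z * g z \<noteq> 0" "z \<in> ball 0 1"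
    using z b(4)[of z] by (auto simp: U_def b_def)
  moreover have "b z * g z = 0" if "z \<in> B" for z
    using that B b(4)[of z] g(4)[of z] by (cases "z \<in> F") (auto simp: b_def)
  ultimately show ?thesis
    by (intro exI[of _ "\<lambda>z. b z * g z"] conjI ballI bexI[of _ z])
qed

section \<open>Separated sets and Poisson kernels\<close>

lemma separatedE:
  assumes "separated \<Lambda>"
  obtains \<delta> where "0 < \<delta>"
    "\<And>z w. z \<in> \<Lambda> \<Longrightarrow> w \<in> \<Lambda> \<Longrightarrow> z \<noteq> w \<Longrightarrow> \<delta> \<le> pseudohyp_dist z w"
proof -
  \<comment> \<open>A real number strictly below the infimum is taken because the infimum is
    \<infinity> when there are fewer than two points.\<close>
  obtain \<delta> where \<delta>: "0 < ereal \<delta>"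
    "ereal \<delta> < (INF z\<in>\<Lambda>. INF w\<in>\<Lambda> - {z}. ereal (pseudohyp_dist z w))"
    using assms ereal_dense2 unfolding separated_def by blast
  have "\<delta> \<le> pseudohyp_dist z w" if "z \<in> \<Lambda>" "w \<in> \<Lambda>" "z \<noteq> w" for z w
  proof -
    have "ereal \<delta> \<le> (INF w\<in>\<Lambda> - {z}. ereal (pseudohyp_dist z w))"
      using \<delta>(2) that by (meson INF_lower less_imp_le order_trans)
    also have "\<dots> \<le> ereal (pseudohyp_dist z w)"
      using that by (intro INF_lower) auto
    finally show ?thesis
      by simp
  qed
  then show thesis
    using that[of \<delta>] \<delta>(1) by simp
qed

lemma norm_1_minus_mult_cnj_ge:
  assumes "cmod z < 1" "cmod w < 1"
  shows "1 - cmod z \<le> cmod (1 - z * cnj w)"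
proof -
  have "cmod (z * cnj w) \<le> cmod z * 1"
    unfolding norm_mult by (intro mult_left_mono) (use assms in auto)
  moreover have "1 - cmod (z * cnj w) \<le> cmod (1 - z * cnj w)"
    by (metis norm_one norm_triangle_ineq2)
  ultimately show ?thesis
    by simp
qed

text \<open>Pseudohyperbolic separation becomes Euclidean separation at scale 1 - |z|. Separation is
  used only in this form.\<close>

lemma pseudohyp_dist_le:
  assumes "cmod z < 1" "cmod w < 1"
  shows "pseudohyp_dist z w * (1 - cmod z) \<le> cmod (z - w)"
proof -
  have "1 - cmod z \<le> cmod (1 - z * cnj w)"
    by (rule norm_1_minus_mult_cnj_ge) fact+
  then have "pseudohyp_dist z w * (1 - cmod z) \<le> pseudohyp_dist z w * cmod (1 - z * cnj w)"
    by (intro mult_left_mono) (auto simp: pseudohyp_dist_def)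
  also have "\<dots> \<le> cmod (z - w)"
    by (simp add: pseudohyp_dist_def norm_divide)
  finally show ?thesis .
qed

text \<open>The distance of two centres dominates \<delta> (1 - |z|) and \<delta> (1 - |w|), hence
  their mean, which is the sum of the two radii. So the discs are disjoint open sets in the
  plane.\<close>

lemma separated_imp_countable:
  assumes "\<Lambda> \<subseteq> ball 0 1" "separated \<Lambda>"
  shows "countable \<Lambda>"
proof -
  obtain \<delta> where \<delta>: "0 < \<delta>"
    "\<And>z w. z \<in> \<Lambda> \<Longrightarrow> w \<in> \<Lambda> \<Longrightarrow> z \<noteq> w \<Longrightarrow> \<delta> \<le> pseudohyp_dist z w"
    using separatedE[OF assms(2)] by blast
  define D where "D z = ball z (\<delta> * (1 - cmod z) / 2)" for z :: complex
  have dist: "\<delta> * (1 - cmod z) \<le> cmod (z - w)" if "z \<in> \<Lambda>" "w \<in> \<Lambda>" "z \<noteq> w" for z w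
  proof -
    have "cmod z < 1" "cmod w < 1"
      using that assms(1) by auto
    then have "\<delta> * (1 - cmod z) \<le> pseudohyp_dist z w * (1 - cmod z)"
      using \<delta>(2)[OF that] by (intro mult_right_mono) auto
    also have "\<dots> \<le> cmod (z - w)"
      by (rule pseudohyp_dist_le) fact+
    finally show ?thesis .
  qed
  have dj: "D z \<inter> D w = {}" if "z \<in> \<Lambda>" "w \<in> \<Lambda>" "z \<noteq> w" for z w
  proof (rule ccontr)
    assume "D z \<inter> D w \<noteq> {}"
    then obtain u where "dist z u < \<delta> * (1 - cmod z) / 2" "dist w u < \<delta> * (1 - cmod w) / 2"
      by (auto simp: D_def)
    moreover have "dist z w \<le> dist z u + dist w u"
      by (rule dist_triangle2)
    ultimately show False
      using dist[OF that] dist[OF that(2,1)] that(3) by (simp add: dist_norm norm_minus_commute)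
  qed
  have cen: "z \<in> D z" if "z \<in> \<Lambda>" for z
    using that assms(1) \<delta>(1) by (auto simp: D_def)
  have "countable (D ` \<Lambda>)"
  proof (rule countable_disjoint_open_subsets)
    show "open S" if "S \<in> D ` \<Lambda>" for S
      using that by (auto simp: D_def)
    show "disjoint (D ` \<Lambda>)"
      unfolding pairwise_def disjnt_def using dj by blast
  qed
  moreover have "inj_on D \<Lambda>"
    using cen dj by (intro inj_onI) blast
  ultimately show ?thesis
    by (rule countable_image_inj_on)
qed

lemma poisson_kernel_nonneg:
  "cmod z < 1 \<Longrightarrow> 0 \<le> poisson_kernel z \<zeta>"
  unfolding poisson_kernel_def by (intro divide_nonneg_nonneg) (simp_all add: power_le_one)

text \<open>The holomorphic function is the Herglotz kernel; through it, multiples of Poisson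
  kernels are available as real parts of holomorphic functions.\<close>

lemma Re_poisson_kernel:
  assumes "cmod \<zeta> = 1" "cmod z < 1"
  shows "Re ((\<zeta> + z) / (\<zeta> - z)) = poisson_kernel z \<zeta>"
proof -
  have "Re ((\<zeta> + z) * cnj (\<zeta> - z)) = (cmod \<zeta>)\<^sup>2 - (cmod z)\<^sup>2"
    unfolding cmod_power2 by (simp add: power2_eq_square algebra_simps)
  then show ?thesis
    using assms by (simp add: poisson_kernel_def complex_div_cnj[of "\<zeta> + z"] flip: of_real_power)
qed

text \<open>Both follow from 1 - |z| \<le> |\<zeta> - z| \<le> 1 + |z|. The upper bound makes the
  convex set of the duality argument bounded at each point; the lower one integrates to Harnack's
  inequality.\<close>

lemma poisson_kernel_bounds:
  assumes "cmod \<zeta> = 1" "cmod z < 1"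
  shows "poisson_kernel z \<zeta> \<le> (1 + cmod z) / (1 - cmod z)"
    "(1 - cmod z) / (1 + cmod z) \<le> poisson_kernel z \<zeta>"
proof -
  have f: "1 - (cmod z)\<^sup>2 = (1 - cmod z) * (1 + cmod z)"
    by (simp add: power2_eq_square algebra_simps)
  have 1: "1 - cmod z \<le> cmod (\<zeta> - z)"
    using norm_triangle_ineq2[of \<zeta> z] assms(1) by simp
  have 2: "cmod (\<zeta> - z) \<le> 1 + cmod z"
    using norm_triangle_ineq4[of \<zeta> z] assms(1) by simp
  have "poisson_kernel z \<zeta> \<le> (1 - (cmod z)\<^sup>2) / (1 - cmod z)\<^sup>2"
    unfolding poisson_kernel_def using 1 assms(2)
    by (intro divide_left_mono power_mono mult_pos_pos zero_less_power) (auto simp: power_le_one)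
  also have "\<dots> = (1 + cmod z) / (1 - cmod z)"
    using assms(2) unfolding f by (simp add: power2_eq_square)
  finally show "poisson_kernel z \<zeta> \<le> (1 + cmod z) / (1 - cmod z)" .
  have "(1 - cmod z) / (1 + cmod z) = (1 - (cmod z)\<^sup>2) / (1 + cmod z)\<^sup>2"
    using add_pos_nonneg[of 1 "cmod z"] unfolding f by (simp add: power2_eq_square)
  also have "\<dots> \<le> poisson_kernel z \<zeta>"
    unfolding poisson_kernel_def using 1 2 assms(2)
    by (intro divide_left_mono power_mono mult_pos_pos zero_less_power) (auto simp: power_le_one)
  finally show "(1 - cmod z) / (1 + cmod z) \<le> poisson_kernel z \<zeta>" .
qed

section \<open>From the Poisson inequality to a small function\<close>

text \<open>Weights supported on a finite set turn the extended-real sums into finite real ones. The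
  slack \<eta> replaces attainment of the supremum, so continuity in \<zeta> is not
  involved.\<close>

lemma poisson_dominatedE:
  assumes "poisson_dominated \<epsilon> \<Gamma>"
  obtains C where "0 < C"
    "\<And>F c \<eta>. finite F \<Longrightarrow> F \<subseteq> \<Gamma> \<Longrightarrow> (\<forall>\<gamma>. 0 \<le> c \<gamma>) \<Longrightarrow> 0 < \<eta> \<Longrightarrow>
       \<exists>\<zeta>. cmod \<zeta> = 1 \<and> (\<Sum>\<gamma>\<in>F. c \<gamma> * ln (inverse (\<epsilon> \<gamma>)))
         \<le> C * (\<Sum>\<gamma>\<in>F. c \<gamma> * poisson_kernel \<gamma> \<zeta>) + \<eta>"
proof -
  obtain C where C: "0 < C" "\<And>c. \<forall>\<gamma>\<in>\<Gamma>. 0 \<le> c \<gamma> \<Longrightarrow>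
      (\<Sum>\<^sub>\<infinity>\<gamma>\<in>\<Gamma>. ereal (c \<gamma> * ln (inverse (\<epsilon> \<gamma>))))
        \<le> ereal C * (SUP \<zeta>\<in>sphere 0 1. \<Sum>\<^sub>\<infinity>\<gamma>\<in>\<Gamma>. ereal (c \<gamma> * poisson_kernel \<gamma> \<zeta>))"
    using assms unfolding poisson_dominated_def by blast
  have "\<exists>\<zeta>. cmod \<zeta> = 1 \<and> (\<Sum>\<gamma>\<in>F. c \<gamma> * ln (inverse (\<epsilon> \<gamma>)))
         \<le> C * (\<Sum>\<gamma>\<in>F. c \<gamma> * poisson_kernel \<gamma> \<zeta>) + \<eta>"
    if F: "finite F" "F \<subseteq> \<Gamma>" and c: "\<forall>\<gamma>. 0 \<le> c \<gamma>" and \<eta>: "0 < \<eta>" for F c \<eta>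
  proof (rule ccontr)
    define L where "L = (\<Sum>\<gamma>\<in>F. c \<gamma> * ln (inverse (\<epsilon> \<gamma>)))"
    assume "\<not> ?thesis"
    then have less: "C * (\<Sum>\<gamma>\<in>F. c \<gamma> * poisson_kernel \<gamma> \<zeta>) + \<eta> < L" if "cmod \<zeta> = 1" for \<zeta>
      using that unfolding L_def by force
    define d where "d \<gamma> = (if \<gamma> \<in> F then c \<gamma> else 0)" for \<gamma>
    have inf: "(\<Sum>\<^sub>\<infinity>\<gamma>\<in>\<Gamma>. ereal (d \<gamma> * h \<gamma>)) = ereal (\<Sum>\<gamma>\<in>F. c \<gamma> * h \<gamma>)" for h
    proof -
      have "(\<Sum>\<^sub>\<infinity>\<gamma>\<in>\<Gamma>. ereal (d \<gamma> * h \<gamma>)) = (\<Sum>\<^sub>\<infinity>\<gamma>\<in>F. ereal (c \<gamma> * h \<gamma>))"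
        by (rule infsum_cong_neutral) (use F in \<open>auto simp: d_def\<close>)
      also have "\<dots> = ereal (\<Sum>\<gamma>\<in>F. c \<gamma> * h \<gamma>)"
        using F(1) by simp
      finally show ?thesis .
    qed
    have "ereal L \<le> ereal C * (SUP \<zeta>\<in>sphere 0 1. ereal (\<Sum>\<gamma>\<in>F. c \<gamma> * poisson_kernel \<gamma> \<zeta>))"
      using C(2)[of d] c unfolding inf L_def by (simp add: d_def)
    also have "\<dots> \<le> ereal C * ereal ((L - \<eta>) / C)"
    proof (intro ereal_mult_left_mono SUP_least)
      fix \<zeta> :: complex assume "\<zeta> \<in> sphere 0 1"
      then show "ereal (\<Sum>\<gamma>\<in>F. c \<gamma> * poisson_kernel \<gamma> \<zeta>) \<le> ereal ((L - \<eta>) / C)"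
        using less[of \<zeta>] C(1) by (simp add: field_simps)
    qed (use C(1) in simp)
    also have "\<dots> = ereal (L - \<eta>)"
      using C(1) by simp
    finally show False
      using \<eta> by simp
  qed
  then show thesis
    using that C(1) by blast
qed

text \<open>For a given weight the best response is a single multiple C P_\<zeta>, with \<zeta>
  depending on the weight. Convexity of \<open>K\<close> exchanges the quantifiers and yields one H
  serving all points of \<open>F\<close> up to the error 1, the source of the 1 in the
  exponent.\<close>

lemma contractive_of_poisson_majorant:
  fixes l :: "complex \<Rightarrow> real"
  assumes F: "finite F" "F \<subseteq> ball 0 1" and C: "0 < C"
    and maj: "\<And>c \<eta>. (\<forall>\<gamma>. 0 \<le> c \<gamma>) \<Longrightarrow> 0 < \<eta> \<Longrightarrow>
       \<exists>\<zeta>. cmod \<zeta> = 1 \<and> (\<Sum>\<gamma>\<in>F. c \<gamma> * l \<gamma>) \<le> C * (\<Sum>\<gamma>\<in>F. c \<gamma> * poisson_kernel \<gamma> \<zeta>) + \<eta>"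
  shows "\<exists>g. g holomorphic_on ball 0 1 \<and> (\<forall>z\<in>ball 0 1. cmod (g z) \<le> 1) \<and>
    exp (- C) \<le> cmod (g 0) \<and> (\<forall>z\<in>F. cmod (g z) \<le> exp (1 - l z))"
proof -
  txt \<open>
    The Harnack bound \<open>M\<close> holds automatically for nonnegative real part; imposing it in the
    definition of \<open>K\<close> saves its proof.
  \<close>
  define M where "M z = C * ((1 + cmod z) / (1 - cmod z))" for z
  define K where "K = {x. \<exists>H. H holomorphic_on ball 0 1 \<and>
    (\<forall>z\<in>ball 0 1. 0 \<le> Re (H z) \<and> Re (H z) \<le> M z) \<and> H 0 = of_real C \<and> x = (\<lambda>z. Re (H z))}"
  have kernel: "(\<lambda>z. Re (of_real C * ((\<zeta> + z) / (\<zeta> - z)))) \<in> K" if \<zeta>: "cmod \<zeta> = 1" for \<zeta>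
    unfolding K_def
  proof (intro CollectI exI[of _ "\<lambda>z. of_real C * ((\<zeta> + z) / (\<zeta> - z))"] conjI ballI refl)
    show "(\<lambda>z. of_real C * ((\<zeta> + z) / (\<zeta> - z))) holomorphic_on ball 0 1"
      using \<zeta> by (intro holomorphic_intros) auto
    show "complex_of_real C * ((\<zeta> + 0) / (\<zeta> - 0)) = complex_of_real C"
      using \<zeta> by auto
    fix z :: complex assume "z \<in> ball 0 1"
    then have z: "cmod z < 1"
      by simp
    have e: "Re (of_real C * ((\<zeta> + z) / (\<zeta> - z))) = C * poisson_kernel z \<zeta>"
      using Re_poisson_kernel[OF \<zeta> z] by (simp only: Re_complex_of_real Im_complex_of_real
          times_complex.sel mult_zero_left diff_zero)
    show "0 \<le> Re (of_real C * ((\<zeta> + z) / (\<zeta> - z)))"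
      "Re (of_real C * ((\<zeta> + z) / (\<zeta> - z))) \<le> M z"
      unfolding e M_def using poisson_kernel_nonneg[OF z] poisson_kernel_bounds(1)[OF \<zeta> z] C
      by (auto intro!: mult_nonneg_nonneg mult_left_mono simp del: times_divide_eq_right)
  qed
  have "\<exists>x\<in>K. \<forall>i\<in>F. l i \<le> x i + 1"
  proof (rule convex_approx_minimax[OF F(1)])
    show "K \<noteq> {}"
      using kernel[of 1] by auto
    show "(\<lambda>i. (1 - t) * x i + t * y i) \<in> K" if xy: "x \<in> K" "y \<in> K" and t: "0 \<le> t" "t \<le> 1" for x y t
    proof -
      obtain H where H: "H holomorphic_on ball 0 1" "H 0 = of_real C" "x = (\<lambda>z. Re (H z))"
        "\<And>z. z \<in> ball 0 1 \<Longrightarrow> 0 \<le> Re (H z) \<and> Re (H z) \<le> M z"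
        using xy(1) unfolding K_def by blast
      obtain J where J: "J holomorphic_on ball 0 1" "J 0 = of_real C" "y = (\<lambda>z. Re (J z))"
        "\<And>z. z \<in> ball 0 1 \<Longrightarrow> 0 \<le> Re (J z) \<and> Re (J z) \<le> M z"
        using xy(2) unfolding K_def by blast
      define G where "G z = of_real (1 - t) * H z + of_real t * J z" for z
      have ReG: "Re (G z) = (1 - t) * Re (H z) + t * Re (J z)" for z
        by (simp add: G_def)
      show ?thesis
        unfolding K_def
      proof (intro CollectI exI[of _ G] conjI ballI)
        show "G holomorphic_on ball 0 1"
          unfolding G_def using H(1) J(1) by (intro holomorphic_intros)
        show "G 0 = of_real C"
          by (simp add: G_def H(2) J(2) algebra_simps)
        show "(\<lambda>i. (1 - t) * x i + t * y i) = (\<lambda>z. Re (G z))"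
          by (simp add: ReG H(3) J(3))
        fix z :: complex assume z: "z \<in> ball 0 1"
        show "0 \<le> Re (G z)"
          unfolding ReG using H(4)[OF z] J(4)[OF z] t by simp
        show "Re (G z) \<le> M z"
          unfolding ReG using H(4)[OF z] J(4)[OF z] t by (intro convex_bound_le) auto
      qed
    qed
    show "\<bar>x i\<bar> \<le> M i" if "x \<in> K" "i \<in> F" for x i
      using that F(2) unfolding K_def by force
    show "\<exists>x\<in>K. (\<Sum>i\<in>F. c i * l i) \<le> (\<Sum>i\<in>F. c i * x i) + \<eta>"
      if c: "\<forall>i. 0 \<le> c i" and \<eta>: "0 < \<eta>" for c \<eta>
    proof -
      obtain \<zeta> where \<zeta>: "cmod \<zeta> = 1"
        "(\<Sum>\<gamma>\<in>F. c \<gamma> * l \<gamma>) \<le> C * (\<Sum>\<gamma>\<in>F. c \<gamma> * poisson_kernel \<gamma> \<zeta>) + \<eta>"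
        using maj[OF c \<eta>] by blast
      have "C * (\<Sum>\<gamma>\<in>F. c \<gamma> * poisson_kernel \<gamma> \<zeta>) =
        (\<Sum>\<gamma>\<in>F. c \<gamma> * Re (of_real C * ((\<zeta> + \<gamma>) / (\<zeta> - \<gamma>))))"
        unfolding sum_distrib_left
      proof (rule sum.cong)
        fix \<gamma> assume "\<gamma> \<in> F"
        then have "cmod \<gamma> < 1"
          using F(2) by auto
        from Re_poisson_kernel[OF \<zeta>(1) this]
        show "C * (c \<gamma> * poisson_kernel \<gamma> \<zeta>) = c \<gamma> * Re (of_real C * ((\<zeta> + \<gamma>) / (\<zeta> - \<gamma>)))"
          by (simp only: Re_complex_of_real Im_complex_of_real
              times_complex.sel mult_zero_left diff_zero mult.left_commute)
      qed simp
      then show ?thesis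
        using \<zeta>(2) by (intro bexI[OF _ kernel[OF \<zeta>(1)]]) simp
    qed
  qed simp
  then obtain H where H: "H holomorphic_on ball 0 1" "H 0 = of_real C"
      "\<And>z. z \<in> ball 0 1 \<Longrightarrow> 0 \<le> Re (H z)" "\<And>z. z \<in> F \<Longrightarrow> l z \<le> Re (H z) + 1"
    unfolding K_def by blast
  show ?thesis
  proof (intro exI[of _ "\<lambda>z. exp (- H z)"] conjI ballI)
    show "(\<lambda>z. exp (- H z)) holomorphic_on ball 0 1"
      using H(1) by (intro holomorphic_intros)
  qed (use H in \<open>auto simp: algebra_simps\<close>)
qed

lemma holomorphic_mult_nonzero:
  assumes "f holomorphic_on S" "g holomorphic_on S" "open S" "connected S"
    and "z \<in> S" "f z \<noteq> 0" "w \<in> S" "g w \<noteq> 0"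
  shows "\<exists>x\<in>S. f x * g x \<noteq> 0"
proof (rule ccontr)
  assume "\<not> ?thesis"
  then have fg: "f x = 0 \<or> g x = 0" if "x \<in> S" for x
    using that by auto
  define U where "U = S \<inter> g -` (-{0})"
  have U: "open U" "U \<subseteq> S" "w \<in> U"
    unfolding U_def using assms
    by (auto intro!: continuous_open_preimage holomorphic_on_imp_continuous_on)
  have "f z = 0"
    by (rule analytic_continuation_open[of U S f "\<lambda>_. 0"]) (use U assms fg in \<open>auto simp: U_def\<close>)
  then show False
    using assms by simp
qed

lemma small_function_of_poisson_dominated:
  assumes \<Gamma>: "countable \<Gamma>" "\<Gamma> \<subseteq> ball 0 1" and pos: "\<And>z. z \<in> B \<union> \<Gamma> \<Longrightarrow> 0 < \<epsilon> z"
    and B: "blaschke B" and dom: "poisson_dominated \<epsilon> \<Gamma>"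
  shows "\<exists>f\<in>H_infty. (\<exists>z\<in>ball 0 1. f z \<noteq> 0) \<and> (\<forall>z\<in>B \<union> \<Gamma>. cmod (f z) < \<epsilon> z)"
proof -
  obtain C where C: "0 < C" "\<And>F c \<eta>. finite F \<Longrightarrow> F \<subseteq> \<Gamma> \<Longrightarrow> (\<forall>\<gamma>. 0 \<le> c \<gamma>) \<Longrightarrow> 0 < \<eta> \<Longrightarrow>
       \<exists>\<zeta>. cmod \<zeta> = 1 \<and> (\<Sum>\<gamma>\<in>F. c \<gamma> * ln (inverse (\<epsilon> \<gamma>)))
         \<le> C * (\<Sum>\<gamma>\<in>F. c \<gamma> * poisson_kernel \<gamma> \<zeta>) + \<eta>"
    using poisson_dominatedE[OF dom] by blast
  have "\<exists>g. g holomorphic_on ball 0 1 \<and> (\<forall>z\<in>ball 0 1. cmod (g z) \<le> 1) \<and>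
      exp (- C) \<le> cmod (g 0) \<and> (\<forall>z\<in>\<Gamma>. cmod (g z) \<le> exp (1 - ln (inverse (\<epsilon> z))))"
  proof (rule contractive_limit_of_finite_approx[OF \<Gamma>])
    fix F assume F: "finite F" "F \<subseteq> \<Gamma>"
    then have "F \<subseteq> ball 0 1"
      using \<Gamma> by blast
    from contractive_of_poisson_majorant[OF F(1) this C(1) C(2)[OF F]]
    show "\<exists>g. g holomorphic_on ball 0 1 \<and> (\<forall>z\<in>ball 0 1. cmod (g z) \<le> 1) \<and>
      exp (- C) \<le> cmod (g 0) \<and> (\<forall>z\<in>F. cmod (g z) \<le> exp (1 - ln (inverse (\<epsilon> z))))"
      by blast
  qed
  then obtain g where g: "g holomorphic_on ball 0 1" "\<And>z. z \<in> ball 0 1 \<Longrightarrow> cmod (g z) \<le> 1"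
      "exp (- C) \<le> cmod (g 0)" "\<And>z. z \<in> \<Gamma> \<Longrightarrow> cmod (g z) \<le> exp (1 - ln (inverse (\<epsilon> z)))"
    by blast
  obtain b z where b: "b holomorphic_on ball 0 1" "\<And>z. z \<in> ball 0 1 \<Longrightarrow> cmod (b z) \<le> 1"
      "z \<in> ball 0 1" "b z \<noteq> 0" "\<And>z. z \<in> B \<Longrightarrow> b z = 0"
    using blaschke_zero_function[OF B] by blast
  have "g 0 \<noteq> 0"
    using g(3) by (metis exp_gt_zero norm_zero not_less)
  then obtain x where x: "x \<in> ball 0 1" "b x * g x \<noteq> 0"
    using holomorphic_mult_nonzero[OF b(1) g(1) _ _ b(3,4), of 0] by auto
  \<comment> \<open>Division by exp 1 cancels the error 1 in the exponent; the factor 2 makes the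
    inequality strict.\<close>
  define f where "f z = b z * g z / of_real (2 * exp 1)" for z
  have nf: "cmod (f z) = cmod (b z) * cmod (g z) / (2 * exp 1)" for z
    by (simp add: f_def norm_mult norm_divide)
  have le: "cmod (f z) \<le> cmod (g z) / (2 * exp 1)" if "z \<in> ball 0 1" for z
    unfolding nf using b(2)[OF that] by (intro divide_right_mono mult_left_le_one_le) auto
  have "f holomorphic_on ball 0 1"
    unfolding f_def using b(1) g(1) by (intro holomorphic_intros) auto
  moreover have "bounded (f ` ball 0 1)"
  proof (rule boundedI)
    fix y assume "y \<in> f ` ball 0 1"
    then obtain z where z: "z \<in> ball 0 1" "y = f z"
      by blast
    have "cmod (g z) / (2 * exp 1) \<le> 1 / (2 * exp 1)"
      by (intro divide_right_mono g(2) z) auto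
    then show "cmod y \<le> 1 / (2 * exp 1)"
      using le[OF z(1)] z(2) by simp
  qed
  moreover have "cmod (f z) < \<epsilon> z" if z: "z \<in> B \<union> \<Gamma>" for z
  proof (cases "z \<in> B")
    case True
    then show ?thesis
      using b(5) pos[OF z] by (simp add: f_def)
  next
    case False
    then have z': "z \<in> \<Gamma>"
      using z by blast
    have "cmod (f z) \<le> exp (1 - ln (inverse (\<epsilon> z))) / (2 * exp 1)"
      by (intro order_trans[OF le] divide_right_mono g(4) z') (use z' \<Gamma>(2) in auto)
    also have "\<dots> = \<epsilon> z / 2"
      using pos[OF z] by (simp add: exp_diff field_simps)
    also have "\<dots> < \<epsilon> z"
      using pos[OF z] by simp
    finally show ?thesis .
  qed
  moreover have "f x \<noteq> 0"
    using x(2) by (simp add: f_def)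
  ultimately show ?thesis
    using x(1) unfolding H_infty_def by blast
qed

section \<open>The Poisson formula and division by zeros\<close>

text \<open>
  This is Cauchy's formula at \<open>\<gamma>\<close> for \<open>H u * ((1 - \<bar>\<gamma>\<bar>\<^sup>2) / (1 - cnj \<gamma> * u))\<close>, since on the
  unit circle \<open>u / ((u - \<gamma>) * (1 - cnj \<gamma> * u)) = 1 / \<bar>u - \<gamma>\<bar>\<^sup>2\<close>.
\<close>

lemma poisson_integral_formula:
  assumes cont: "continuous_on (cball 0 1) H" and hol: "H holomorphic_on ball 0 1"
    and \<gamma>: "cmod \<gamma> < 1"
  shows "((\<lambda>x. Re (H (circlepath 0 1 x)) * poisson_kernel \<gamma> (circlepath 0 1 x))
    has_integral Re (H \<gamma>)) {0..1}"
proof -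
  define G where "G u = H u * (of_real (1 - (cmod \<gamma>)\<^sup>2) / (1 - cnj \<gamma> * u))" for u
  have nz: "1 - cnj \<gamma> * u \<noteq> 0" if "cmod u \<le> 1" for u
  proof
    assume "1 - cnj \<gamma> * u = 0"
    then have "cmod \<gamma> * cmod u = 1"
      by (metis complex_mod_cnj eq_iff_diff_eq_0 norm_mult norm_one)
    moreover have "cmod \<gamma> * cmod u \<le> cmod \<gamma> * 1"
      using that by (intro mult_left_mono) auto
    ultimately show False
      using \<gamma> by simp
  qed
  have "((\<lambda>u. G u / (u - \<gamma>)) has_contour_integral (2 * of_real pi * \<i> * G \<gamma>)) (circlepath 0 1)"
  proof (rule Cauchy_integral_circlepath)
    show "continuous_on (cball 0 1) G"
      unfolding G_def using nz by (intro continuous_intros cont) auto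
    show "G holomorphic_on ball 0 1"
      unfolding G_def using nz by (intro holomorphic_intros hol) auto
  qed (use \<gamma> in auto)
  moreover have "G \<gamma> = H \<gamma>"
  proof -
    have "1 - cnj \<gamma> * \<gamma> = of_real (1 - (cmod \<gamma>)\<^sup>2)"
      by (metis complex_norm_square mult.commute of_real_1 of_real_diff of_real_power)
    then show ?thesis
      using nz[of \<gamma>] \<gamma> by (simp add: G_def)
  qed
  ultimately have "((\<lambda>x. G (circlepath 0 1 x) / (circlepath 0 1 x - \<gamma>) *
      (2 * of_real pi * \<i> * exp (2 * of_real pi * \<i> * x))) has_integral (2 * of_real pi * \<i> * H \<gamma>)) {0..1}"
    by (simp add: has_contour_integral vector_derivative_circlepath)
  then have "((\<lambda>x. inverse (2 * of_real pi * \<i>) * (G (circlepath 0 1 x) / (circlepath 0 1 x - \<gamma>) *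
      (2 * of_real pi * \<i> * exp (2 * of_real pi * \<i> * x)))) has_integral
      (inverse (2 * of_real pi * \<i>) * (2 * of_real pi * \<i> * H \<gamma>))) {0..1}"
    by (rule has_integral_mult_right)
  then have "((\<lambda>x. H (circlepath 0 1 x) * of_real (poisson_kernel \<gamma> (circlepath 0 1 x)))
      has_integral H \<gamma>) {0..1}"
  proof (rule has_integral_eq_rhs[OF has_integral_eq, rotated])
    fix x :: real
    define u where "u = circlepath 0 1 x"
    have u: "u = exp (2 * of_real pi * \<i> * x)"
      by (simp add: u_def circlepath)
    have nu: "cmod u = 1"
      unfolding u by (simp add: norm_exp_eq_Re)
    then have "u \<noteq> \<gamma>"
      using \<gamma> by auto
    have "u * cnj u = 1"
      using nu by (simp add: complex_norm_square[symmetric])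
    then have f: "1 - cnj \<gamma> * u = u * cnj (u - \<gamma>)"
      by (simp add: algebra_simps)
    have pk: "complex_of_real (poisson_kernel \<gamma> u) =
        of_real (1 - (cmod \<gamma>)\<^sup>2) / ((u - \<gamma>) * cnj (u - \<gamma>))"
      unfolding poisson_kernel_def complex_norm_square[symmetric] by simp
    \<comment> \<open>Used with \<open>T\<close> = 2 pi i, \<open>v\<close> =
      \<open>cnj (u - \<gamma>)\<close> and \<open>y = u - \<gamma>\<close>. The factor
      \<open>u\<close> coming from the derivative of the path cancels the one in 1 - cnj \<gamma>
      u.\<close>
    have cancel: "inverse T * (H u * (D / (u * v)) / y * (T * u)) = H u * (D / (y * v))"
      if "T \<noteq> 0" "v \<noteq> 0" "y \<noteq> 0" for T D v y
      using that nu by (auto simp: field_simps)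
    show "inverse (2 * of_real pi * \<i>) * (G (circlepath 0 1 x) / (circlepath 0 1 x - \<gamma>) *
        (2 * of_real pi * \<i> * exp (2 * of_real pi * \<i> * x))) =
        H (circlepath 0 1 x) * of_real (poisson_kernel \<gamma> (circlepath 0 1 x))"
      unfolding u[symmetric] u_def[symmetric] G_def f pk using \<open>u \<noteq> \<gamma>\<close>
      by (intro cancel) auto
  qed (subst mult.assoc[symmetric], subst left_inverse, auto)
  from has_integral_linear[OF this bounded_linear_Re] show ?thesis
    by (simp add: o_def)
qed

lemma cmod_circlepath_0_1 [simp]: "cmod (circlepath 0 1 x) = 1"
  by (simp add: circlepath norm_exp_eq_Re)

text \<open>The sum is moved under the Poisson integral, where the weighted kernels are at most
  \<open>S\<close> pointwise; the nonnegative boundary density Re H has integral Re H(0).\<close>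

lemma positive_harmonic_sum_le:
  assumes cont: "continuous_on (cball 0 1) H" and hol: "H holomorphic_on ball 0 1"
    and pos: "\<And>z. cmod z = 1 \<Longrightarrow> 0 \<le> Re (H z)"
    and F: "finite F" "F \<subseteq> ball 0 1"
    and S: "\<And>\<zeta>. cmod \<zeta> = 1 \<Longrightarrow> (\<Sum>\<gamma>\<in>F. c \<gamma> * poisson_kernel \<gamma> \<zeta>) \<le> S"
  shows "(\<Sum>\<gamma>\<in>F. c \<gamma> * Re (H \<gamma>)) \<le> S * Re (H 0)"
proof -
  have "((\<lambda>x. \<Sum>\<gamma>\<in>F. c \<gamma> * (Re (H (circlepath 0 1 x)) * poisson_kernel \<gamma> (circlepath 0 1 x)))
      has_integral (\<Sum>\<gamma>\<in>F. c \<gamma> * Re (H \<gamma>))) {0..1}"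
    using F by (intro has_integral_sum has_integral_mult_right poisson_integral_formula[OF cont hol]) auto
  \<comment> \<open>The kernel at 0 is identically 1 on the circle, so this is the mean value
    property.\<close>
  moreover have "((\<lambda>x. S * (Re (H (circlepath 0 1 x)) * poisson_kernel 0 (circlepath 0 1 x)))
      has_integral S * Re (H 0)) {0..1}"
    by (intro has_integral_mult_right poisson_integral_formula[OF cont hol]) auto
  ultimately show ?thesis
  proof (rule has_integral_le)
    fix x :: real
    define u where "u = circlepath 0 1 x"
    have u: "cmod u = 1"
      by (simp add: u_def)
    have "(\<Sum>\<gamma>\<in>F. c \<gamma> * (Re (H u) * poisson_kernel \<gamma> u)) =
        (\<Sum>\<gamma>\<in>F. c \<gamma> * poisson_kernel \<gamma> u) * Re (H u)"
      unfolding sum_distrib_right by (intro sum.cong) simp_all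
    also have "\<dots> \<le> S * Re (H u)"
      using S[OF u] pos[OF u] by (rule mult_right_mono)
    finally show "(\<Sum>\<gamma>\<in>F. c \<gamma> * (Re (H (circlepath 0 1 x)) * poisson_kernel \<gamma> (circlepath 0 1 x)))
      \<le> S * (Re (H (circlepath 0 1 x)) * poisson_kernel 0 (circlepath 0 1 x))"
      using u by (simp add: u_def[symmetric] poisson_kernel_def)
  qed
qed

text \<open>Pairing with the weights produces the value at 0, whereas \<open>f\<close> is controlled
  from below only at \<open>a\<close>.\<close>

lemma harnack_at_0:
  assumes cont: "continuous_on (cball 0 1) H" and hol: "H holomorphic_on ball 0 1"
    and pos: "\<And>z. cmod z = 1 \<Longrightarrow> 0 \<le> Re (H z)" and a: "cmod a < 1"
  shows "Re (H 0) \<le> (1 + cmod a) / (1 - cmod a) * Re (H a)"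
proof -
  have "(1 - cmod a) / (1 + cmod a) * Re (H 0) \<le> Re (H a)"
  proof (rule has_integral_le)
    show "((\<lambda>x. (1 - cmod a) / (1 + cmod a) *
        (Re (H (circlepath 0 1 x)) * poisson_kernel 0 (circlepath 0 1 x)))
      has_integral (1 - cmod a) / (1 + cmod a) * Re (H 0)) {0..1}"
      by (intro has_integral_mult_right poisson_integral_formula[OF cont hol]) auto
    show "((\<lambda>x. Re (H (circlepath 0 1 x)) * poisson_kernel a (circlepath 0 1 x))
      has_integral Re (H a)) {0..1}"
      by (rule poisson_integral_formula[OF cont hol a])
    fix x :: real
    define u where "u = circlepath 0 1 x"
    have u: "cmod u = 1"
      by (simp add: u_def)
    have "(1 - cmod a) / (1 + cmod a) * Re (H u) \<le> poisson_kernel a u * Re (H u)"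
      using poisson_kernel_bounds(2)[OF u a] pos[OF u] by (rule mult_right_mono)
    then show "(1 - cmod a) / (1 + cmod a) *
        (Re (H (circlepath 0 1 x)) * poisson_kernel 0 (circlepath 0 1 x))
      \<le> Re (H (circlepath 0 1 x)) * poisson_kernel a (circlepath 0 1 x)"
      using u by (simp add: u_def[symmetric] poisson_kernel_def mult.commute)
  qed
  then have "(1 + cmod a) / (1 - cmod a) * ((1 - cmod a) / (1 + cmod a) * Re (H 0)) \<le>
      (1 + cmod a) / (1 - cmod a) * Re (H a)"
    using a by (intro mult_left_mono) auto
  moreover have "(1 + cmod a) / (1 - cmod a) * ((1 - cmod a) / (1 + cmod a) * Re (H 0)) = Re (H 0)"
    using a add_pos_nonneg[of 1 "cmod a"] by simp
  ultimately show ?thesis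
    by simp
qed

section \<open>Dividing out zeros\<close>

text \<open>The disc automorphism exchanging w and 0 up to sign moves the zero to the origin, where
  the quotient by z is again bounded by 1 by the Schwarz lemma.\<close>

lemma schwarz_division:
  assumes hol: "f holomorphic_on ball 0 1" and le: "\<And>z. z \<in> ball 0 1 \<Longrightarrow> cmod (f z) \<le> 1"
    and w: "cmod w < 1" "f w = 0"
  obtains g where "g holomorphic_on ball 0 1" "\<And>z. z \<in> ball 0 1 \<Longrightarrow> cmod (g z) \<le> 1"
    "\<And>z. z \<in> ball 0 1 \<Longrightarrow> f z = Moebius_function 0 w z * g z"
proof -
  have M: "Moebius_function 0 w z \<in> ball 0 1" "Moebius_function 0 (-w) z \<in> ball 0 1"
    if "z \<in> ball 0 1" for z
    using that w Moebius_function_norm_lt_1 by auto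
  have Mh: "Moebius_function 0 w holomorphic_on ball 0 1" "Moebius_function 0 (-w) holomorphic_on ball 0 1"
    using w by (auto intro: Moebius_function_holomorphic)
  define F where "F z = f (Moebius_function 0 (-w) z)" for z
  have F: "F holomorphic_on ball 0 1"
    unfolding F_def using M(2)
    by (intro holomorphic_on_compose_gen[OF Mh(2) hol, unfolded o_def]) auto
  have F0: "F 0 = 0"
    using w by (simp add: F_def Moebius_function_of_zero)
  have Fle: "cmod (F z) \<le> 1" if "z \<in> ball 0 1" for z
    unfolding F_def using M(2)[OF that] le by blast
  obtain h where h: "h holomorphic_on ball 0 1" "\<And>z. cmod z < 1 \<Longrightarrow> F z = z * h z" "deriv F 0 = h 0"
    using Schwarz3[OF F F0] by blast
  \<comment> \<open>\<open>Schwarz_Lemma\<close> asks for strict inequality, but only |F| \<le> 1 is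
    known; it is applied to t F, and t tends to 1. The derivative bound covers the quotient at
    0.\<close>
  have sch: "t * cmod (F z) \<le> cmod z" "t * cmod (deriv F 0) \<le> 1"
    if "0 < t" "t < 1" "cmod z < 1" for t z
  proof -
    have lt: "cmod (of_real t * F x) < 1" if "cmod x < 1" for x
    proof -
      have "t * cmod (F x) \<le> t * 1"
        using \<open>0 < t\<close> Fle[of x] that by (intro mult_left_mono) auto
      then have "t * cmod (F x) < 1"
        using \<open>t < 1\<close> by linarith
      then show ?thesis
        unfolding norm_mult norm_of_real abs_of_pos[OF \<open>0 < t\<close>] .
    qed
    have hol': "(\<lambda>z. of_real t * F z) holomorphic_on ball 0 1"
      using F by (intro holomorphic_intros)
    have z0: "of_real t * F 0 = 0"
      by (simp add: F0)
    have "F field_differentiable at 0"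
      using F by (intro holomorphic_on_imp_differentiable_at[of _ "ball 0 1"]) auto
    then have "deriv (\<lambda>z. of_real t * F z) 0 = of_real t * deriv F 0"
      by (rule deriv_cmult)
    then show "t * cmod (F z) \<le> cmod z" "t * cmod (deriv F 0) \<le> 1"
      using Schwarz_Lemma(1)[OF hol' z0 lt that(3)] Schwarz_Lemma(2)[OF hol' z0 lt that(3)] that(1)
      by (simp_all add: norm_mult)
  qed
  have lim: "x \<le> y" if "\<And>t. 0 < t \<Longrightarrow> t < 1 \<Longrightarrow> t * x \<le> y" for x y :: real
    using that by (rule field_le_mult_one_interval)
  have hle: "cmod (h z) \<le> 1" if z: "z \<in> ball 0 1" for z
  proof (cases "z = 0")
    case True
    show ?thesis
      unfolding True h(3)[symmetric] by (rule lim, rule sch(2)[of _ 0]) simp_all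
  next
    case False
    have "cmod (F z) \<le> cmod z"
      by (rule lim, rule sch(1)) (use z in simp_all)
    then show ?thesis
      using h(2)[of z] z False by (simp add: norm_mult)
  qed
  show thesis
  proof (rule that[of "\<lambda>z. h (Moebius_function 0 w z)"])
    show "(\<lambda>z. h (Moebius_function 0 w z)) holomorphic_on ball 0 1"
      using M(1) by (intro holomorphic_on_compose_gen[OF Mh(1) h(1), unfolded o_def]) auto
    fix z :: complex assume z: "z \<in> ball 0 1"
    show "cmod (h (Moebius_function 0 w z)) \<le> 1"
      by (intro hle M z)
    have "Moebius_function 0 (-w) (Moebius_function 0 w z) = z"
      using w z by (intro Moebius_function_compose) auto
    then have "f z = F (Moebius_function 0 w z)"
      by (simp add: F_def)
    then show "f z = Moebius_function 0 w z * h (Moebius_function 0 w z)"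
      using h(2) M(1)[OF z] by simp
  qed
qed

lemma one_minus_cmod_Moebius_sq:
  assumes "cmod w < 1" "cmod z < 1"
  shows "1 - (cmod (Moebius_function 0 w z))\<^sup>2 =
    (1 - (cmod z)\<^sup>2) * (1 - (cmod w)\<^sup>2) / (cmod (1 - cnj w * z))\<^sup>2"
proof -
  have "cmod (cnj w * z) < 1"
    using norm_mult_less[of "cnj w" 1 z 1] assms by simp
  then have "1 - cnj w * z \<noteq> 0"
    by auto
  moreover have "(cmod (1 - cnj w * z))\<^sup>2 - (cmod (z - w))\<^sup>2 = (1 - (cmod z)\<^sup>2) * (1 - (cmod w)\<^sup>2)"
    unfolding cmod_power2 by (simp add: power2_eq_square algebra_simps)
  ultimately show ?thesis
    by (simp add: Moebius_function_simple norm_divide power_divide field_simps)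
qed

lemma one_minus_cmod_Moebius_sq_ge:
  assumes "cmod w < 1" "cmod z < 1"
  shows "(1 - (cmod z)\<^sup>2) * (1 - (cmod w)\<^sup>2) / 4 \<le> 1 - (cmod (Moebius_function 0 w z))\<^sup>2"
proof -
  have le: "cmod (cnj w * z) < 1"
    using norm_mult_less[of "cnj w" 1 z 1] assms by simp
  then have "1 - cnj w * z \<noteq> 0"
    by auto
  moreover have "cmod (1 - cnj w * z) \<le> 2"
    using norm_triangle_ineq4[of 1 "cnj w * z"] le by simp
  then have "(cmod (1 - cnj w * z))\<^sup>2 \<le> 2\<^sup>2"
    by (intro power_mono) auto
  ultimately show ?thesis
    unfolding one_minus_cmod_Moebius_sq[OF assms] using assms
    by (intro divide_left_mono mult_nonneg_nonneg) (auto simp: power_le_one)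
qed

text \<open>
  Zeros are divided out one at a time. Each division increases the modulus at \<open>a\<close> by a fixed
  factor, while the quotient stays bounded by 1, so the process stops; no multiplicities are needed.
\<close>

lemma zero_factorization:
  assumes hol: "f holomorphic_on ball 0 1" and le: "\<And>z. z \<in> ball 0 1 \<Longrightarrow> cmod (f z) \<le> 1"
    and a: "cmod a < 1" "f a \<noteq> 0" and r: "0 \<le> r" "r < 1"
  obtains n and w :: "nat \<Rightarrow> complex" and g where
    "\<And>k. k < n \<Longrightarrow> cmod (w k) \<le> r" "\<And>k. k < n \<Longrightarrow> f (w k) = 0"
    "g holomorphic_on ball 0 1" "\<And>z. z \<in> ball 0 1 \<Longrightarrow> cmod (g z) \<le> 1"
    "\<And>z. z \<in> ball 0 1 \<Longrightarrow> f z = (\<Prod>k<n. Moebius_function 0 (w k) z) * g z"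
    "\<And>z. cmod z \<le> r \<Longrightarrow> g z \<noteq> 0"
proof -
  define P where "P n \<longleftrightarrow> (\<exists>w :: nat \<Rightarrow> complex. \<exists>g. (\<forall>k<n. cmod (w k) \<le> r \<and> f (w k) = 0) \<and>
    g holomorphic_on ball 0 1 \<and> (\<forall>z\<in>ball 0 1. cmod (g z) \<le> 1) \<and>
    (\<forall>z\<in>ball 0 1. f z = (\<Prod>k<n. Moebius_function 0 (w k) z) * g z))" for n
  have P0: "P 0"
    unfolding P_def using hol le by auto
  \<comment> \<open>An upper bound, below 1, for the squared modulus at \<open>a\<close> of any
    Blaschke factor with zero in |w| \<le> r. With n factors extracted, |f(a)|^2 \<le> q^n, which
    limits n.\<close>
  define q where "q = 1 - (1 - (cmod a)\<^sup>2) * (1 - r\<^sup>2) / 4"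
  have "0 < (1 - (cmod a)\<^sup>2) * (1 - r\<^sup>2)"
    using a r by (intro mult_pos_pos) (auto simp: power_less_one_iff abs_square_less_1)
  moreover have "(1 - (cmod a)\<^sup>2) * (1 - r\<^sup>2) \<le> 1"
    using a r by (intro mult_le_one) (auto simp: power_le_one)
  ultimately have q: "0 \<le> q" "q < 1"
    by (auto simp: q_def)
  have Pq: "(cmod (f a))\<^sup>2 \<le> q ^ n" if Pn: "P n" for n
  proof -
    obtain w g where w: "\<And>k. k < n \<Longrightarrow> cmod (w k) \<le> r"
      "cmod (g a) \<le> 1" "f a = (\<Prod>k<n. Moebius_function 0 (w k) a) * g a"
      using Pn a(1) unfolding P_def by (metis mem_ball_0)
    have "(cmod (Moebius_function 0 (w k) a))\<^sup>2 \<le> q" if "k < n" for k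
    proof -
      have "cmod (w k) < 1"
        using w(1)[OF that] r by simp
      note one_minus_cmod_Moebius_sq_ge[OF this a(1)]
      moreover have "(1 - (cmod a)\<^sup>2) * (1 - r\<^sup>2) / 4 \<le> (1 - (cmod a)\<^sup>2) * (1 - (cmod (w k))\<^sup>2) / 4"
        using w(1)[OF that] a r by (intro divide_right_mono mult_left_mono diff_left_mono power_mono)
          (auto simp: power_le_one)
      ultimately show ?thesis
        by (simp add: q_def)
    qed
    then have "(\<Prod>k<n. (cmod (Moebius_function 0 (w k) a))\<^sup>2) \<le> (\<Prod>k<n. q)"
      by (intro prod_mono) auto
    moreover have "(cmod (f a))\<^sup>2 = (\<Prod>k<n. (cmod (Moebius_function 0 (w k) a))\<^sup>2) * (cmod (g a))\<^sup>2"
      unfolding w(3) norm_mult prod_norm[symmetric] power_mult_distrib prod_power_distrib ..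
    moreover have "\<dots> \<le> (\<Prod>k<n. (cmod (Moebius_function 0 (w k) a))\<^sup>2) * 1"
      using w(2) by (intro mult_left_mono prod_nonneg) (auto simp: power_le_one)
    ultimately show ?thesis
      by simp
  qed
  obtain N where N: "q ^ N < (cmod (f a))\<^sup>2"
    using real_arch_pow_inv[of "(cmod (f a))\<^sup>2" q] a(2) q(2) by auto
  have bnd: "n \<le> N" if "P n" for n
  proof (rule ccontr)
    assume "\<not> n \<le> N"
    then have "q ^ n \<le> q ^ N"
      using q by (intro power_decreasing) auto
    then show False
      using Pq[OF that] N by simp
  qed
  \<comment> \<open>Maximality is what makes the quotient zero-free: a further zero in |z| \<le> r
    would supply factor number n + 1.\<close>
  define n where "n = (GREATEST n. P n)"
  have Pn: "P n"
    unfolding n_def using P0 bnd by (rule GreatestI_nat)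
  have notP: "\<not> P (Suc n)"
    using Greatest_le_nat[of P "Suc n" N] bnd unfolding n_def by (metis Suc_n_not_le_n)
  obtain w g where w: "\<And>k. k < n \<Longrightarrow> cmod (w k) \<le> r" "\<And>k. k < n \<Longrightarrow> f (w k) = 0"
    and g: "g holomorphic_on ball 0 1" "\<And>z. z \<in> ball 0 1 \<Longrightarrow> cmod (g z) \<le> 1"
    "\<And>z. z \<in> ball 0 1 \<Longrightarrow> f z = (\<Prod>k<n. Moebius_function 0 (w k) z) * g z"
    using Pn unfolding P_def by metis
  have "g v \<noteq> 0" if v: "cmod v \<le> r" for v
  proof
    assume gv: "g v = 0"
    have v1: "cmod v < 1"
      using v r by simp
    obtain h where h: "h holomorphic_on ball 0 1" "\<And>z. z \<in> ball 0 1 \<Longrightarrow> cmod (h z) \<le> 1"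
      "\<And>z. z \<in> ball 0 1 \<Longrightarrow> g z = Moebius_function 0 v z * h z"
      using schwarz_division[OF g(1,2) v1 gv] by metis
    define w' where "w' = w(n := v)"
    have "P (Suc n)"
      unfolding P_def
    proof (intro exI[of _ w'] exI[of _ h] conjI ballI allI impI)
      fix k assume "k < Suc n"
      then show "cmod (w' k) \<le> r" "f (w' k) = 0"
        using w[of k] v g(3)[of v] v1 gv by (auto simp: w'_def less_Suc_eq)
    next
      fix z :: complex assume z: "z \<in> ball 0 1"
      have "(\<Prod>k<n. Moebius_function 0 (w' k) z) = (\<Prod>k<n. Moebius_function 0 (w k) z)"
        by (intro prod.cong) (auto simp: w'_def)
      then show "f z = (\<Prod>k<Suc n. Moebius_function 0 (w' k) z) * h z"
        using g(3)[OF z] h(3)[OF z] by (simp add: w'_def)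
    qed (use h in auto)
    then show False
      using notP by blast
  qed
  then show thesis
    using that[OF w g] by blast
qed

section \<open>Lower bounds for the logarithm away from the zeros\<close>

text \<open>A Jensen-type estimate: x \<le> exp (x - 1) turns the product at \<open>a\<close> into a
  sum. Of the 8, a factor 2 comes from squaring moduli and a factor 4 from |1 - cnj w a| \<le>
  2.\<close>

lemma zeros_sum_le:
  fixes w :: "nat \<Rightarrow> complex"
  assumes a: "cmod a < 1" "f a \<noteq> 0"
    and w: "\<And>k. k < n \<Longrightarrow> cmod (w k) < 1"
    and g: "cmod (g a) \<le> 1" "f a = (\<Prod>k<n. Moebius_function 0 (w k) a) * g a"
  shows "(\<Sum>k<n. 1 - (cmod (w k))\<^sup>2) \<le> - 8 * ln (cmod (f a)) / (1 - (cmod a)\<^sup>2)"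
proof -
  define m where "m k = (cmod (Moebius_function 0 (w k) a))\<^sup>2" for k
  have a1: "0 < 1 - (cmod a)\<^sup>2"
    using a(1) by (simp add: abs_square_less_1)
  have "(cmod (f a))\<^sup>2 = (\<Prod>k<n. m k) * (cmod (g a))\<^sup>2"
    unfolding g(2) norm_mult prod_norm[symmetric] power_mult_distrib prod_power_distrib m_def ..
  also have "\<dots> \<le> (\<Prod>k<n. m k) * 1"
    using g(1) by (intro mult_left_mono prod_nonneg) (auto simp: power_le_one m_def)
  also have "\<dots> \<le> (\<Prod>k<n. exp (m k - 1))"
    unfolding mult_1_right
  proof (rule prod_mono)
    fix k
    show "0 \<le> m k \<and> m k \<le> exp (m k - 1)"
      using exp_ge_add_one_self[of "m k - 1"] by (simp add: m_def)
  qed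
  also have "\<dots> = exp (- (\<Sum>k<n. 1 - m k))"
    unfolding sum_negf[symmetric] by (subst exp_sum) simp_all
  finally have "ln ((cmod (f a))\<^sup>2) \<le> ln (exp (- (\<Sum>k<n. 1 - m k)))"
    using a(2) by (subst ln_le_cancel_iff) auto
  then have "(\<Sum>k<n. 1 - m k) \<le> - 2 * ln (cmod (f a))"
    using a(2) by (simp add: ln_realpow)
  moreover have "(\<Sum>k<n. (1 - (cmod a)\<^sup>2) * (1 - (cmod (w k))\<^sup>2) / 4) \<le> (\<Sum>k<n. 1 - m k)"
    unfolding m_def using w a(1) by (intro sum_mono one_minus_cmod_Moebius_sq_ge) auto
  moreover have "(\<Sum>k<n. (1 - (cmod a)\<^sup>2) * (1 - (cmod (w k))\<^sup>2) / 4) =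
      (1 - (cmod a)\<^sup>2) / 4 * (\<Sum>k<n. 1 - (cmod (w k))\<^sup>2)"
    unfolding sum_distrib_left by (intro sum.cong) auto
  ultimately have "(1 - (cmod a)\<^sup>2) / 4 * (\<Sum>k<n. 1 - (cmod (w k))\<^sup>2) \<le> - 2 * ln (cmod (f a))"
    by linarith
  then show ?thesis
    unfolding pos_le_divide_eq[OF a1] by (simp add: algebra_simps)
qed

text \<open>With \<open>r\<close> the largest modulus in \<open>Z\<close>, the zero-free quotient
  forces every point of \<open>Z\<close> to be among the extracted zeros; repetitions only enlarge
  the sum. The bound is uniform in \<open>Z\<close>, so it yields a Blaschke condition.\<close>

lemma finite_zeros_sum_le:
  assumes hol: "f holomorphic_on ball 0 1" and le: "\<And>z. z \<in> ball 0 1 \<Longrightarrow> cmod (f z) \<le> 1"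
    and a: "cmod a < 1" "f a \<noteq> 0"
    and Z: "finite Z" "Z \<subseteq> {z \<in> ball 0 1. f z = 0}"
  shows "(\<Sum>z\<in>Z. 1 - cmod z) \<le> - 8 * ln (cmod (f a)) / (1 - (cmod a)\<^sup>2)"
proof -
  define r where "r = Max (insert 0 (cmod ` Z))"
  have r: "0 \<le> r" "r < 1" "\<And>z. z \<in> Z \<Longrightarrow> cmod z \<le> r"
    using Z by (auto simp: r_def)
  obtain n and w :: "nat \<Rightarrow> complex" and g where
    w: "\<And>k. k < n \<Longrightarrow> cmod (w k) \<le> r"
    and g: "\<And>z. z \<in> ball 0 1 \<Longrightarrow> cmod (g z) \<le> 1"
    "\<And>z. z \<in> ball 0 1 \<Longrightarrow> f z = (\<Prod>k<n. Moebius_function 0 (w k) z) * g z"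
    "\<And>z. cmod z \<le> r \<Longrightarrow> g z \<noteq> 0"
    using zero_factorization[OF hol le a r(1,2)] by metis
  have w1: "cmod (w k) < 1" if "k < n" for k
    using w[OF that] r(2) by simp
  have sub: "Z \<subseteq> w ` {..<n}"
  proof
    fix z assume z: "z \<in> Z"
    then have "cmod z < 1" "f z = 0"
      using Z(2) by auto
    then have "(\<Prod>k<n. Moebius_function 0 (w k) z) = 0"
      using g(2)[of z] g(3)[OF r(3)[OF z]] by simp
    then obtain k where "k < n" "Moebius_function 0 (w k) z = 0"
      by auto
    then show "z \<in> w ` {..<n}"
      using Moebius_function_0_eq_zero_iff[OF w1 \<open>cmod z < 1\<close>] by auto
  qed
  have "(\<Sum>z\<in>Z. 1 - cmod z) \<le> (\<Sum>z\<in>w ` {..<n}. 1 - cmod z)"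
    using sub w1 by (intro sum_mono2) (auto simp: less_imp_le)
  also have "\<dots> \<le> (\<Sum>k<n. 1 - cmod (w k))"
    using w1 sum_image_le[of "{..<n}" "\<lambda>z. 1 - cmod z" w] by (simp add: less_imp_le)
  also have "\<dots> \<le> (\<Sum>k<n. 1 - (cmod (w k))\<^sup>2)"
  proof (rule sum_mono)
    fix k assume "k \<in> {..<n}"
    then have "cmod (w k) * cmod (w k) \<le> cmod (w k) * 1"
      using w1[of k] by (intro mult_left_mono) auto
    then show "1 - cmod (w k) \<le> 1 - (cmod (w k))\<^sup>2"
      by (simp add: power2_eq_square)
  qed
  also have "\<dots> \<le> - 8 * ln (cmod (f a)) / (1 - (cmod a)\<^sup>2)"
    using a g w1 by (intro zeros_sum_le[where g = g]) auto
  finally show ?thesis .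
qed

text \<open>The condition on \<open>s\<close> lets the dilate x = s \<gamma> lose at most half of
  its guaranteed distance from w, so the Blaschke factor at x stays above \<mu> = \<kappa> /
  (\<kappa> + 8). For its square q this gives -ln q \<le> (1 - q) / \<mu>^2, and 1 - q is at most 8
  (1 - |w|^2) P_\<gamma>(\<zeta>). Passing from q back to the modulus halves the 8.\<close>

lemma Moebius_log_le_poisson_kernel:
  assumes \<gamma>: "cmod \<gamma> < 1" and w: "cmod w < 1" and \<zeta>: "cmod \<zeta> = 1" "w = of_real (cmod w) * \<zeta>"
    and \<kappa>: "0 < \<kappa>" "\<kappa> \<le> 1" and s: "0 < s" "s < 1" "2 * (1 - s) \<le> \<kappa> * (1 - cmod \<gamma>)"
    and far: "\<kappa> * (1 - cmod \<gamma>) \<le> cmod (\<gamma> - w)"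
  shows "- ln (cmod (Moebius_function 0 w (of_real s * \<gamma>)))
    \<le> 4 * ((\<kappa> + 8) / \<kappa>)\<^sup>2 * (1 - (cmod w)\<^sup>2) * poisson_kernel \<gamma> \<zeta>"
proof -
  define x where "x = of_real s * \<gamma>"
  define p where "p = cmod \<gamma>"
  have p: "0 \<le> p" "p < 1"
    using \<gamma> by (auto simp: p_def)
  have nx: "cmod x = s * p"
    using s by (simp add: x_def p_def norm_mult)
  have sp: "s * p \<le> p" "s * p < 1"
    using s p mult_left_le_one_le[of p s] by auto
  have x1: "cmod x < 1"
    using nx sp by simp
  have "cmod (\<gamma> - x) = (1 - s) * p"
  proof -
    have "\<gamma> - x = of_real (1 - s) * \<gamma>"
      by (simp add: x_def algebra_simps)
    then show ?thesis
      using s(2) by (simp only: norm_mult norm_of_real p_def)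
  qed
  also have "\<dots> \<le> 1 - s"
    using s p mult_left_le[of p "1 - s"] by simp
  finally have "cmod (\<gamma> - x) \<le> \<kappa> * (1 - p) / 2"
    using s(3) by (simp add: p_def)
  moreover have "cmod (\<gamma> - w) \<le> cmod (\<gamma> - x) + cmod (x - w)"
    using norm_triangle_ineq[of "\<gamma> - x" "x - w"] by simp
  ultimately have xw: "\<kappa> * (1 - p) / 2 \<le> cmod (x - w)"
    using far unfolding p_def by linarith
  have x2: "1 - (cmod x)\<^sup>2 \<le> 2 * (1 - p\<^sup>2)"
  proof -
    have "p\<^sup>2 * (1 - s\<^sup>2) \<le> 1 * (1 - s\<^sup>2)"
      using p s by (intro mult_right_mono) (auto simp: power_le_one)
    also have "1 * (1 - s\<^sup>2) = (1 - s) * (1 + s)"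
      by (simp add: power2_eq_square algebra_simps)
    also have "\<dots> \<le> (1 - s) * 2"
      using s by (intro mult_left_mono) auto
    also have "\<dots> \<le> \<kappa> * (1 - p)"
      using s(3) by (simp add: p_def mult.commute)
    also have "\<dots> \<le> 1 * (1 - p)"
      using \<kappa> p by (intro mult_right_mono) auto
    also have "\<dots> \<le> 1 - p\<^sup>2"
      using p mult_left_le[of p p] by (simp add: power2_eq_square)
    finally show ?thesis
      by (simp add: nx power_mult_distrib algebra_simps)
  qed
  have "p\<^sup>2 \<ge> 2 * p - 1"
    using zero_le_power2[of "p - 1"] by (simp add: power2_eq_square algebra_simps)
  then have "\<kappa> * (1 - (cmod x)\<^sup>2) \<le> \<kappa> * (4 * (1 - p))"
    using x2 \<kappa> by (intro mult_left_mono) auto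
  \<comment> \<open>The 8 is 4 times 2: 1 - |x|^2 \<le> 4 (1 - p), and \<kappa> (1 - p) is at most
    twice |x - w|.\<close>
  then have x3: "\<kappa> * (1 - (cmod x)\<^sup>2) \<le> 8 * cmod (x - w)"
    using xw by (simp add: algebra_simps)
  have nz: "1 - cnj w * x \<noteq> 0"
  proof -
    have "cmod (cnj w * x) < 1"
      using norm_mult_less[of "cnj w" 1 x 1] w x1 by simp
    then show ?thesis
      by auto
  qed
  have "of_real (1 - (cmod x)\<^sup>2) = 1 - x * cnj x"
    by (metis complex_norm_square of_real_1 of_real_diff of_real_power)
  then have "1 - cnj w * x = of_real (1 - (cmod x)\<^sup>2) + x * cnj (x - w)"
    by (simp add: algebra_simps)
  then have "cmod (1 - cnj w * x) \<le> cmod (of_real (1 - (cmod x)\<^sup>2)) + cmod (x * cnj (x - w))"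
    by (metis norm_triangle_ineq)
  also have "cmod (of_real (1 - (cmod x)\<^sup>2)) = 1 - (cmod x)\<^sup>2"
    using x1 by (simp only: norm_of_real) (simp add: power_le_one)
  also have "cmod (x * cnj (x - w)) \<le> cmod (x - w)"
    unfolding norm_mult complex_mod_cnj using x1 by (intro mult_left_le_one_le) auto
  finally have "\<kappa> * cmod (1 - cnj w * x) \<le> \<kappa> * (1 - (cmod x)\<^sup>2 + cmod (x - w))"
    using \<kappa> by (intro mult_left_mono) auto
  then have "\<kappa> * cmod (1 - cnj w * x) \<le> (\<kappa> + 8) * cmod (x - w)"
    using x3 by (simp add: algebra_simps)
  then have "\<kappa> / (\<kappa> + 8) \<le> cmod (Moebius_function 0 w x)"
    using nz \<kappa>(1) by (simp add: Moebius_function_simple norm_divide field_simps)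
  moreover define \<mu> where "\<mu> = \<kappa> / (\<kappa> + 8)"
  ultimately have M: "0 < \<mu>" "\<mu> \<le> cmod (Moebius_function 0 w x)"
    using \<kappa>(1) by simp_all
  define q where "q = (cmod (Moebius_function 0 w x))\<^sup>2"
  have q: "\<mu>\<^sup>2 \<le> q" "0 < \<mu>\<^sup>2" "q \<le> 1"
    unfolding q_def using M Moebius_function_norm_lt_1[OF w x1, of 0]
    by (auto intro: power_mono simp: power_le_one)
  have q0: "0 < q"
    using q(1,2) by linarith
  then have "- ln q = ln (inverse q)"
    by (simp add: ln_inverse)
  also have "\<dots> \<le> inverse q - 1"
    using q0 by (intro ln_le_minus_one) auto
  also have "\<dots> = (1 - q) / q"
    using q0 by (simp add: field_simps)
  also have "\<dots> \<le> (1 - q) / \<mu>\<^sup>2"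
    using q q0 by (intro divide_left_mono mult_pos_pos) auto
  finally have lnq: "- ln q \<le> (1 - q) / \<mu>\<^sup>2" .
  have lnM: "- ln (cmod (Moebius_function 0 w x)) = - ln q / 2"
    unfolding q_def using M by (simp add: ln_realpow)
  \<comment> \<open>Replacing \<gamma> by x and \<zeta> by w changes 1 - cnj \<zeta> \<gamma> by at
    most 1 - s |w|, which is itself at most |1 - cnj w x|; hence the factor 2.\<close>
  have \<zeta>x: "cmod (\<zeta> - \<gamma>) \<le> 2 * cmod (1 - cnj w * x)"
  proof -
    have "\<zeta> * cnj \<zeta> = 1"
      using \<zeta>(1) by (simp add: complex_norm_square[symmetric])
    then have "\<zeta> - \<gamma> = \<zeta> * (1 - cnj \<zeta> * \<gamma>)"
      by (simp add: algebra_simps mult.assoc[symmetric])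
    then have "cmod (\<zeta> - \<gamma>) = cmod (1 - cnj \<zeta> * \<gamma>)"
      using \<zeta>(1) by (simp add: norm_mult)
    also have "1 - cnj \<zeta> * \<gamma> = (1 - cnj w * x) - of_real (1 - s * cmod w) * (cnj \<zeta> * \<gamma>)"
      by (subst \<zeta>(2)) (simp add: x_def algebra_simps)
    also have "cmod \<dots> \<le> cmod (1 - cnj w * x) + cmod (of_real (1 - s * cmod w) * (cnj \<zeta> * \<gamma>))"
      by (rule norm_triangle_ineq4)
    also have "cmod (of_real (1 - s * cmod w) * (cnj \<zeta> * \<gamma>)) \<le> 1 - s * cmod w"
    proof -
      have "s * cmod w \<le> 1"
        using s w by (intro mult_le_one) auto
      then have "cmod (of_real (1 - s * cmod w) * (cnj \<zeta> * \<gamma>)) = (1 - s * cmod w) * p"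
        unfolding norm_mult norm_of_real p_def using \<zeta>(1) by simp
      also have "\<dots> \<le> 1 - s * cmod w"
        using p \<open>s * cmod w \<le> 1\<close> by (intro mult_left_le) auto
      finally show ?thesis .
    qed
    also have "1 - s * cmod w \<le> 1 - cmod (cnj w * x)"
      using s p w mult_left_le[of p "s * cmod w"] by (simp add: norm_mult nx algebra_simps)
    also have "\<dots> \<le> cmod (1 - cnj w * x)"
      by (metis norm_one norm_triangle_ineq2)
    finally show ?thesis
      by simp
  qed
  have "0 < cmod (\<zeta> - \<gamma>)"
    using \<zeta>(1) \<gamma> by auto
  have "1 - q = (1 - (cmod x)\<^sup>2) * (1 - (cmod w)\<^sup>2) / (cmod (1 - cnj w * x))\<^sup>2"
    unfolding q_def by (rule one_minus_cmod_Moebius_sq[OF w x1])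
  also have "\<dots> \<le> (2 * (1 - p\<^sup>2)) * (1 - (cmod w)\<^sup>2) / (cmod (\<zeta> - \<gamma>) / 2)\<^sup>2"
    using x2 \<zeta>x w p \<open>0 < cmod (\<zeta> - \<gamma>)\<close>
    by (intro frac_le mult_right_mono power_mono mult_nonneg_nonneg) (auto simp: power_le_one)
  also have "\<dots> = 8 * ((1 - (cmod w)\<^sup>2) * poisson_kernel \<gamma> \<zeta>)"
    by (simp add: poisson_kernel_def p_def power_divide)
  finally have "(1 - q) / \<mu>\<^sup>2 \<le> 8 * ((1 - (cmod w)\<^sup>2) * poisson_kernel \<gamma> \<zeta>) / \<mu>\<^sup>2"
    by (rule divide_right_mono) simp
  moreover have "8 * ((1 - (cmod w)\<^sup>2) * poisson_kernel \<gamma> \<zeta>) / \<mu>\<^sup>2 =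
      2 * (4 * ((\<kappa> + 8) / \<kappa>)\<^sup>2 * (1 - (cmod w)\<^sup>2) * poisson_kernel \<gamma> \<zeta>)"
    by (simp add: \<mu>_def power_divide)
  ultimately show ?thesis
    using lnM lnq unfolding x_def by linarith
qed

text \<open>At \<open>s * \<gamma>\<close>, -ln |f| is the sum of the Blaschke terms and of Re H.
  Each Blaschke term is compared with the kernel at one boundary point, so its weighted sum costs a
  multiple of (1 - |w|^2) S, and these add up by the Jensen-type estimate. Re H is paired through
  the Poisson formula. Nothing on the right depends on \<open>s\<close>.\<close>

lemma log_sum_le_dilated:
  assumes hol: "f holomorphic_on ball 0 1" and le: "\<And>z. z \<in> ball 0 1 \<Longrightarrow> cmod (f z) \<le> 1"
    and a: "cmod a < 1" "f a \<noteq> 0" and \<kappa>: "0 < \<kappa>" "\<kappa> \<le> 1"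
    and F: "finite F" "F \<subseteq> ball 0 1"
    and far: "\<And>\<gamma> z. \<gamma> \<in> F \<Longrightarrow> z \<in> ball 0 1 \<Longrightarrow> f z = 0 \<Longrightarrow> \<kappa> * (1 - cmod \<gamma>) \<le> cmod (\<gamma> - z)"
    and c: "\<And>\<gamma>. \<gamma> \<in> F \<Longrightarrow> 0 \<le> c \<gamma>"
    and S: "\<And>\<zeta>. cmod \<zeta> = 1 \<Longrightarrow> (\<Sum>\<gamma>\<in>F. c \<gamma> * poisson_kernel \<gamma> \<zeta>) \<le> S"
    and s: "0 < s" "s < 1" "\<And>\<gamma>. \<gamma> \<in> F \<Longrightarrow> 2 * (1 - s) \<le> \<kappa> * (1 - cmod \<gamma>)"
    and sa: "cmod (f a) / 2 \<le> cmod (f (of_real s * a))"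
  shows "(\<Sum>\<gamma>\<in>F. c \<gamma> * - ln (cmod (f (of_real s * \<gamma>)))) \<le>
    (4 * ((\<kappa> + 8) / \<kappa>)\<^sup>2 * (- 8 * ln (cmod (f a)) / (1 - (cmod a)\<^sup>2)) +
     (1 + cmod a) / (1 - cmod a) * - ln (cmod (f a) / 2)) * S"
proof -
  define D where "D = 4 * ((\<kappa> + 8) / \<kappa>)\<^sup>2"
  define J where "J = - 8 * ln (cmod (f a)) / (1 - (cmod a)\<^sup>2)"
  define A where "A = (1 + cmod a) / (1 - cmod a)"
  have D0: "0 \<le> D"
    by (simp add: D_def)
  have A0: "0 \<le> A"
    using a by (simp add: A_def)
  have S0: "0 \<le> S"
  proof -
    have "0 \<le> (\<Sum>\<gamma>\<in>F. c \<gamma> * poisson_kernel \<gamma> 1)"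
      using F c by (intro sum_nonneg mult_nonneg_nonneg poisson_kernel_nonneg) auto
    then show ?thesis
      using S[of 1] by simp
  qed
  \<comment> \<open>Strictly between \<open>s\<close> and 1, so that z \<mapsto> s z maps the closed
    disc into the open disc on which the logarithm of \<open>g\<close> exists.\<close>
  define r where "r = (1 + s) / 2"
  have r: "0 \<le> r" "r < 1" "s < r"
    using s by (auto simp: r_def)
  obtain n and w :: "nat \<Rightarrow> complex" and g where
    w: "\<And>k. k < n \<Longrightarrow> cmod (w k) \<le> r" "\<And>k. k < n \<Longrightarrow> f (w k) = 0"
    and g: "g holomorphic_on ball 0 1" "\<And>z. z \<in> ball 0 1 \<Longrightarrow> cmod (g z) \<le> 1"
    "\<And>z. z \<in> ball 0 1 \<Longrightarrow> f z = (\<Prod>k<n. Moebius_function 0 (w k) z) * g z"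
    "\<And>z. cmod z \<le> r \<Longrightarrow> g z \<noteq> 0"
  proof -
    show ?thesis
      by (rule zero_factorization[OF hol le a r(1,2)], assumption, rule that)
  qed
  have w1: "cmod (w k) < 1" if "k < n" for k
    using w(1)[OF that] r by simp
  have dil: "cmod (of_real s * z) < r" "cmod (of_real s * z) < 1" if "cmod z \<le> 1" for z
  proof -
    have "cmod (of_real s * z) \<le> s"
      using mult_left_le[of "cmod z" s] that s(1) by (simp only: norm_mult norm_of_real abs_of_pos)
    then show "cmod (of_real s * z) < r" "cmod (of_real s * z) < 1"
      using r by linarith+
  qed
  have "g holomorphic_on ball 0 r"
    by (rule holomorphic_on_subset[OF g(1)]) (use r in auto)
  moreover have "\<forall>z\<in>ball 0 r. g z \<noteq> 0"
    using g(4) by auto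
  ultimately obtain L where L: "L holomorphic_on ball 0 r" "\<And>z. z \<in> ball 0 r \<Longrightarrow> g z = exp (L z)"
    using contractible_imp_holomorphic_log[of g "ball 0 r"]
    by (metis convex_ball convex_imp_contractible)
  define H where "H z = - L (of_real s * z)" for z
  have H: "H holomorphic_on cball 0 1"
    unfolding H_def using dil
    by (intro holomorphic_intros holomorphic_on_compose_gen[OF _ L(1), unfolded o_def]) auto
  then have H': "continuous_on (cball 0 1) H" "H holomorphic_on ball 0 1"
    by (auto intro: holomorphic_on_imp_continuous_on holomorphic_on_subset)
  have ReH: "Re (H z) = - ln (cmod (g (of_real s * z)))" if "cmod z \<le> 1" for z
    using L(2)[of "of_real s * z"] dil[OF that] by (simp add: H_def)
  have Hpos: "0 \<le> Re (H z)" if "cmod z = 1" for z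
    using ReH[of z] g(2)[of "of_real s * z"] g(4)[of "of_real s * z"] dil[of z] that by auto
  \<comment> \<open>Blaschke factors have modulus at most 1, so |g(s a)| \<ge> |f(s a)| \<ge> |f(a)|
    / 2; this bounds Re H(a), and Harnack then bounds Re H(0).\<close>
  have H0: "Re (H 0) \<le> A * - ln (cmod (f a) / 2)"
  proof -
    have "cmod (f (of_real s * a)) = (\<Prod>k<n. cmod (Moebius_function 0 (w k) (of_real s * a))) *
        cmod (g (of_real s * a))"
      using g(3)[of "of_real s * a"] dil(2)[of a] a by (simp add: norm_mult prod_norm)
    also have "\<dots> \<le> 1 * cmod (g (of_real s * a))"
      using dil(2)[of a] a w1
      by (intro mult_right_mono prod_le_1) (auto intro!: less_imp_le[OF Moebius_function_norm_lt_1])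
    finally have "cmod (f a) / 2 \<le> cmod (g (of_real s * a))"
      using sa by simp
    then have "ln (cmod (f a) / 2) \<le> ln (cmod (g (of_real s * a)))"
      using a(2) by (subst ln_le_cancel_iff) (auto intro: less_le_trans[of 0 "cmod (f a) / 2"])
    then have "Re (H a) \<le> - ln (cmod (f a) / 2)"
      using ReH[of a] a by simp
    then have "A * Re (H a) \<le> A * - ln (cmod (f a) / 2)"
      using A0 by (rule mult_left_mono)
    moreover have "Re (H 0) \<le> A * Re (H a)"
      unfolding A_def by (rule harnack_at_0[OF H' Hpos a(1)])
    ultimately show ?thesis
      by simp
  qed
  have Hsum: "(\<Sum>\<gamma>\<in>F. c \<gamma> * Re (H \<gamma>)) \<le> S * (A * - ln (cmod (f a) / 2))"
    using positive_harmonic_sum_le[OF H' Hpos F S] mult_left_mono[OF H0 S0] by simp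
  define m where "m k \<gamma> = - ln (cmod (Moebius_function 0 (w k) (of_real s * \<gamma>)))" for k \<gamma>
  have msum: "(\<Sum>\<gamma>\<in>F. c \<gamma> * m k \<gamma>) \<le> D * (1 - (cmod (w k))\<^sup>2) * S" if k: "k < n" for k
  proof -
    \<comment> \<open>The radial projection of the zero to the circle; a zero at the origin may be
      given any direction.\<close>
    define \<zeta> where "\<zeta> = (if w k = 0 then 1 else w k / of_real (cmod (w k)))"
    have \<zeta>: "cmod \<zeta> = 1" "w k = of_real (cmod (w k)) * \<zeta>"
      by (auto simp: \<zeta>_def norm_divide)
    have "(\<Sum>\<gamma>\<in>F. c \<gamma> * m k \<gamma>) \<le>
        (\<Sum>\<gamma>\<in>F. c \<gamma> * (D * (1 - (cmod (w k))\<^sup>2) * poisson_kernel \<gamma> \<zeta>))"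
    proof (intro sum_mono mult_left_mono c)
      fix \<gamma> assume \<gamma>: "\<gamma> \<in> F"
      then have "cmod \<gamma> < 1"
        using F(2) by auto
      moreover have "\<kappa> * (1 - cmod \<gamma>) \<le> cmod (\<gamma> - w k)"
        using far[OF \<gamma>] w(2)[OF k] w1[OF k] by simp
      ultimately show "m k \<gamma> \<le> D * (1 - (cmod (w k))\<^sup>2) * poisson_kernel \<gamma> \<zeta>"
        unfolding m_def D_def using w1[OF k] \<zeta> \<kappa> s(1,2) s(3)[OF \<gamma>]
        by (intro Moebius_log_le_poisson_kernel)
    qed
    also have "\<dots> = D * (1 - (cmod (w k))\<^sup>2) * (\<Sum>\<gamma>\<in>F. c \<gamma> * poisson_kernel \<gamma> \<zeta>)"
      unfolding sum_distrib_left by (intro sum.cong) (simp_all only: mult_ac)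
    also have "\<dots> \<le> D * (1 - (cmod (w k))\<^sup>2) * S"
      using D0 w1[OF k] by (intro mult_left_mono S \<zeta> mult_nonneg_nonneg) (auto simp: power_le_one)
    finally show ?thesis .
  qed
  have split: "- ln (cmod (f (of_real s * \<gamma>))) = (\<Sum>k<n. m k \<gamma>) + Re (H \<gamma>)" if \<gamma>: "\<gamma> \<in> F" for \<gamma>
  proof -
    define x where "x = of_real s * \<gamma>"
    have g1: "cmod \<gamma> < 1"
      using \<gamma> F(2) by auto
    have x: "cmod x < 1" "g x \<noteq> 0"
      using dil[of \<gamma>] g1 g(4)[of x] by (auto simp: x_def)
    have nz: "Moebius_function 0 (w k) x \<noteq> 0" if k: "k < n" for k
    proof
      assume "Moebius_function 0 (w k) x = 0"
      then have "x = w k"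
        using Moebius_function_0_eq_zero_iff[OF w1[OF k] x(1)] by simp
      then have "\<kappa> * (1 - cmod \<gamma>) \<le> cmod (\<gamma> - x)"
        using far[OF \<gamma>] w(2)[OF k] x(1) by simp
      also have "\<gamma> - x = of_real (1 - s) * \<gamma>"
        by (simp add: x_def algebra_simps)
      also have "cmod \<dots> \<le> 1 - s"
        using s g1 by (simp only: norm_mult norm_of_real) (simp add: mult_left_le)
      \<comment> \<open>The dilate is within 1 - s of \<gamma>, but every zero is at least 2 (1 - s)
        away, so no factor vanishes at the dilate.\<close>
      finally have "2 * (1 - s) \<le> 1 - s"
        using s(3)[OF \<gamma>] by simp
      then show False
        using s by simp
    qed
    have "ln (cmod (f x)) = ln ((\<Prod>k<n. cmod (Moebius_function 0 (w k) x)) * cmod (g x))"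
      using g(3)[of x] x(1) by (simp add: norm_mult prod_norm)
    also have "\<dots> = ln (\<Prod>k<n. cmod (Moebius_function 0 (w k) x)) + ln (cmod (g x))"
      using nz x by (intro ln_mult_pos prod_pos) auto
    also have "ln (\<Prod>k<n. cmod (Moebius_function 0 (w k) x)) =
        (\<Sum>k<n. ln (cmod (Moebius_function 0 (w k) x)))"
      using nz by (intro ln_prod) auto
    finally show ?thesis
      using ReH[of \<gamma>] g1 by (simp add: m_def x_def sum_negf)
  qed
  have "(\<Sum>\<gamma>\<in>F. c \<gamma> * - ln (cmod (f (of_real s * \<gamma>)))) =
      (\<Sum>\<gamma>\<in>F. (\<Sum>k<n. c \<gamma> * m k \<gamma>) + c \<gamma> * Re (H \<gamma>))"
    by (intro sum.cong) (simp_all only: split sum_distrib_left distrib_left)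
  also have "\<dots> = (\<Sum>k<n. \<Sum>\<gamma>\<in>F. c \<gamma> * m k \<gamma>) + (\<Sum>\<gamma>\<in>F. c \<gamma> * Re (H \<gamma>))"
    unfolding sum.distrib by (subst sum.swap) simp
  also have "\<dots> \<le> (\<Sum>k<n. D * (1 - (cmod (w k))\<^sup>2) * S) + S * (A * - ln (cmod (f a) / 2))"
    by (intro add_mono sum_mono msum Hsum) auto
  also have "(\<Sum>k<n. D * (1 - (cmod (w k))\<^sup>2) * S) = D * S * (\<Sum>k<n. 1 - (cmod (w k))\<^sup>2)"
    unfolding sum_distrib_left by (intro sum.cong) (simp_all only: mult_ac)
  also have "\<dots> \<le> D * S * J"
    unfolding J_def using a g w1 D0 S0
    by (intro mult_left_mono zeros_sum_le[where g = g] mult_nonneg_nonneg) auto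
  finally show ?thesis
    unfolding D_def J_def A_def by (simp add: algebra_simps)
qed

text \<open>The limit s \<longlonglongrightarrow> 1 from the left of the dilated estimate.
  \<open>F\<close> is finite, so the conditions on \<open>s\<close> hold near 1; \<open>far\<close>
  with z = \<gamma> shows \<open>f \<gamma> \<noteq> 0\<close>, so the logarithms converge.\<close>

lemma log_sum_le:
  assumes hol: "f holomorphic_on ball 0 1" and le: "\<And>z. z \<in> ball 0 1 \<Longrightarrow> cmod (f z) \<le> 1"
    and a: "cmod a < 1" "f a \<noteq> 0" and \<kappa>: "0 < \<kappa>" "\<kappa> \<le> 1"
    and F: "finite F" "F \<subseteq> ball 0 1"
    and far: "\<And>\<gamma> z. \<gamma> \<in> F \<Longrightarrow> z \<in> ball 0 1 \<Longrightarrow> f z = 0 \<Longrightarrow> \<kappa> * (1 - cmod \<gamma>) \<le> cmod (\<gamma> - z)"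
    and c: "\<And>\<gamma>. \<gamma> \<in> F \<Longrightarrow> 0 \<le> c \<gamma>"
    and S: "\<And>\<zeta>. cmod \<zeta> = 1 \<Longrightarrow> (\<Sum>\<gamma>\<in>F. c \<gamma> * poisson_kernel \<gamma> \<zeta>) \<le> S"
  shows "(\<Sum>\<gamma>\<in>F. c \<gamma> * - ln (cmod (f \<gamma>))) \<le>
    (4 * ((\<kappa> + 8) / \<kappa>)\<^sup>2 * (- 8 * ln (cmod (f a)) / (1 - (cmod a)\<^sup>2)) +
     (1 + cmod a) / (1 - cmod a) * - ln (cmod (f a) / 2)) * S"
proof (rule tendsto_upperbound)
  have lim: "((\<lambda>s. f (of_real s * z)) \<longlongrightarrow> f z) (at_left (1::real))" if "cmod z < 1" for z
  proof -
    have "isCont f z"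
      using hol that by (intro continuous_on_interior[of "ball 0 1"] holomorphic_on_imp_continuous_on) auto
    moreover have "((\<lambda>s. of_real s * z) \<longlongrightarrow> of_real 1 * z) (at_left (1::real))"
      by (intro tendsto_intros)
    ultimately show ?thesis
      by (intro isCont_tendsto_compose[of z f]) simp_all
  qed
  show "((\<lambda>s. \<Sum>\<gamma>\<in>F. c \<gamma> * - ln (cmod (f (of_real s * \<gamma>)))) \<longlongrightarrow>
      (\<Sum>\<gamma>\<in>F. c \<gamma> * - ln (cmod (f \<gamma>)))) (at_left (1::real))"
  proof (intro tendsto_sum tendsto_mult tendsto_const tendsto_minus tendsto_ln tendsto_norm)
    fix \<gamma> assume \<gamma>: "\<gamma> \<in> F"
    then have g1: "cmod \<gamma> < 1"
      using F by auto
    then show "((\<lambda>s. f (of_real s * \<gamma>)) \<longlongrightarrow> f \<gamma>) (at_left (1::real))"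
      by (rule lim)
    have "0 < \<kappa> * (1 - cmod \<gamma>)"
      using \<kappa> g1 by simp
    then show "cmod (f \<gamma>) \<noteq> 0"
      using far[OF \<gamma>, of \<gamma>] g1 by auto
  qed
  have "\<forall>\<^sub>F s in at_left (1::real). 0 < s"
    by (rule eventually_at_leftI[of 0]) auto
  moreover have "\<forall>\<^sub>F s in at_left (1::real). s < 1"
    by (rule eventually_at_leftI[of 0]) auto
  moreover have "\<forall>\<^sub>F s in at_left (1::real). \<forall>\<gamma>\<in>F. 2 * (1 - s) \<le> \<kappa> * (1 - cmod \<gamma>)"
  proof (intro eventually_ball_finite F ballI)
    fix \<gamma> assume "\<gamma> \<in> F"
    then have "0 < \<kappa> * (1 - cmod \<gamma>)"
      using \<kappa> F by auto
    then show "\<forall>\<^sub>F s in at_left (1::real). 2 * (1 - s) \<le> \<kappa> * (1 - cmod \<gamma>)"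
      by (intro eventually_at_leftI[of "1 - \<kappa> * (1 - cmod \<gamma>) / 2"]) auto
  qed
  moreover have "\<forall>\<^sub>F s in at_left (1::real). cmod (f a) / 2 < cmod (f (of_real s * a))"
    using a by (intro order_tendstoD(1)[OF tendsto_norm[OF lim[OF a(1)]]]) auto
  ultimately show "\<forall>\<^sub>F s in at_left (1::real).
    (\<Sum>\<gamma>\<in>F. c \<gamma> * - ln (cmod (f (of_real s * \<gamma>)))) \<le>
    (4 * ((\<kappa> + 8) / \<kappa>)\<^sup>2 * (- 8 * ln (cmod (f a)) / (1 - (cmod a)\<^sup>2)) +
     (1 + cmod a) / (1 - cmod a) * - ln (cmod (f a) / 2)) * S"
  proof eventually_elim
    case (elim s)
    show ?case
      by (rule log_sum_le_dilated[OF hol le a \<kappa> F far c S]) (use elim in auto)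
  qed
qed simp

section \<open>The two directions of the equivalence\<close>

text \<open>Kernel terms are nonnegative, so partial sums on the right stay below the full sum; a
  bound common to all finite partial sums on the left passes to the infinite sum.\<close>

lemma poisson_dominatedI:
  assumes \<Gamma>: "\<Gamma> \<subseteq> ball 0 1"
    and bound: "\<And>F c S. finite F \<Longrightarrow> F \<subseteq> \<Gamma> \<Longrightarrow> (\<And>\<gamma>. \<gamma> \<in> F \<Longrightarrow> 0 \<le> c \<gamma>) \<Longrightarrow>
      (\<And>\<zeta>. cmod \<zeta> = 1 \<Longrightarrow> (\<Sum>\<gamma>\<in>F. c \<gamma> * poisson_kernel \<gamma> \<zeta>) \<le> S) \<Longrightarrow>
      (\<Sum>\<gamma>\<in>F. c \<gamma> * ln (inverse (\<epsilon> \<gamma>))) \<le> C * S"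
  shows "poisson_dominated \<epsilon> \<Gamma>"
  unfolding poisson_dominated_def
\<comment> \<open>\<open>C\<close> may be nonpositive; the maximum is a legitimate constant and
  makes the product \<infinity> when the supremum is infinite.\<close>
proof (intro exI[of _ "max C 1"] conjI allI impI)
  fix c :: "complex \<Rightarrow> real" assume c: "\<forall>\<gamma>\<in>\<Gamma>. 0 \<le> c \<gamma>"
  define L where "L \<gamma> = ereal (c \<gamma> * ln (inverse (\<epsilon> \<gamma>)))" for \<gamma>
  define U where "U \<zeta> = (\<Sum>\<^sub>\<infinity>\<gamma>\<in>\<Gamma>. ereal (c \<gamma> * poisson_kernel \<gamma> \<zeta>))" for \<zeta>
  have nn: "0 \<le> ereal (c \<gamma> * poisson_kernel \<gamma> \<zeta>)" if "\<gamma> \<in> \<Gamma>" for \<gamma> \<zeta>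
    using c that \<Gamma> poisson_kernel_nonneg[of \<gamma> \<zeta>] by (auto intro!: mult_nonneg_nonneg)
  have "infsum L \<Gamma> \<le> ereal (max C 1) * (SUP \<zeta>\<in>sphere 0 1. U \<zeta>)"
  proof (cases "(SUP \<zeta>\<in>sphere 0 1. U \<zeta>) = \<infinity>")
    case True
    have "0 < max C 1"
      by simp
    then show ?thesis
      unfolding True times_ereal.simps by simp
  next
    case False
    have U1: "U \<zeta> \<le> (SUP \<zeta>\<in>sphere 0 1. U \<zeta>)" if "cmod \<zeta> = 1" for \<zeta>
      using that by (intro SUP_upper) auto
    have "0 \<le> U 1"
      unfolding U_def using nn by (intro infsum_nonneg) auto
    then have S0: "0 \<le> (SUP \<zeta>\<in>sphere 0 1. U \<zeta>)"
      using U1[of 1] by simp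
    then obtain S where S: "(SUP \<zeta>\<in>sphere 0 1. U \<zeta>) = ereal S" "0 \<le> S"
      using False by (cases "SUP \<zeta>\<in>sphere 0 1. U \<zeta>") auto
    have fin: "sum L F \<le> ereal (max C 1 * S)" if F: "finite F" "F \<subseteq> \<Gamma>" for F
    proof -
      have "(\<Sum>\<gamma>\<in>F. c \<gamma> * poisson_kernel \<gamma> \<zeta>) \<le> S" if "cmod \<zeta> = 1" for \<zeta>
      proof -
        have "(\<Sum>\<^sub>\<infinity>\<gamma>\<in>F. ereal (c \<gamma> * poisson_kernel \<gamma> \<zeta>)) \<le> U \<zeta>"
          unfolding U_def using F nn
          by (intro infsum_mono_neutral nonneg_summable_on_complete) auto
        also have "\<dots> \<le> ereal S"
          using U1[OF that] S by simp
        finally show ?thesis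
          using F(1) by simp
      qed
      then have "(\<Sum>\<gamma>\<in>F. c \<gamma> * ln (inverse (\<epsilon> \<gamma>))) \<le> C * S"
        using F c by (intro bound) auto
      also have "\<dots> \<le> max C 1 * S"
        using S(2) by (intro mult_right_mono) auto
      finally show ?thesis
        by (simp add: L_def)
    qed
    have "infsum L \<Gamma> \<le> ereal (max C 1 * S)"
    proof (cases "L summable_on \<Gamma>")
      case True
      then show ?thesis
        using fin by (rule infsum_le_finite_sums)
    next
      \<comment> \<open>Here \<open>infsum\<close> takes its default value 0, and the right-hand
        side is nonnegative.\<close>
      case False
      then show ?thesis
        using S(2) by (simp add: infsum_not_exists)
    qed
    then show ?thesis
      unfolding S(1) times_ereal.simps .
  qed
  then show "(\<Sum>\<^sub>\<infinity>\<gamma>\<in>\<Gamma>. ereal (c \<gamma> * ln (inverse (\<epsilon> \<gamma>))))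
      \<le> ereal (max C 1) * (SUP \<zeta>\<in>sphere 0 1. \<Sum>\<^sub>\<infinity>\<gamma>\<in>\<Gamma>. ereal (c \<gamma> * poisson_kernel \<gamma> \<zeta>))"
    unfolding L_def U_def .
qed simp

text \<open>Two points charged to one zero would be closer than \<kappa> (1 - |b|) + \<kappa> (1 -
  |b'|), while separation keeps them at least 2 \<kappa> times the larger of 1 - |b| and 1 - |b'|
  apart. \<kappa> \<le> 1/2 makes 1 - |b| at most twice the weight of its zero.\<close>

lemma blaschke_near_zeros:
  assumes hol: "f holomorphic_on ball 0 1" and le: "\<And>z. z \<in> ball 0 1 \<Longrightarrow> cmod (f z) \<le> 1"
    and a: "cmod a < 1" "f a \<noteq> 0"
    and B: "B \<subseteq> ball 0 1" and \<kappa>: "\<kappa> \<le> 1 / 2"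
    and sep: "\<And>z w. z \<in> B \<Longrightarrow> w \<in> B \<Longrightarrow> z \<noteq> w \<Longrightarrow> 2 * \<kappa> \<le> pseudohyp_dist z w"
    and near: "\<And>b. b \<in> B \<Longrightarrow> \<exists>z\<in>ball 0 1. f z = 0 \<and> cmod (b - z) < \<kappa> * (1 - cmod b)"
  shows "blaschke B"
proof -
  obtain z where z: "\<And>b. b \<in> B \<Longrightarrow> z b \<in> ball 0 1" "\<And>b. b \<in> B \<Longrightarrow> f (z b) = 0"
    "\<And>b. b \<in> B \<Longrightarrow> cmod (b - z b) < \<kappa> * (1 - cmod b)"
    using near by metis
  have B1: "cmod b < 1" if "b \<in> B" for b
    using that B by auto
  have inj: "inj_on z B"
  proof (rule inj_onI, rule ccontr)
    fix b b' assume b: "b \<in> B" "b' \<in> B" "z b = z b'" "b \<noteq> b'"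
    have "cmod (b - b') \<le> cmod (b - z b) + cmod (b' - z b')"
      using norm_triangle_ineq4[of "b - z b" "b' - z b'"] b(3) by simp
    then have "cmod (b - b') < \<kappa> * (1 - cmod b) + \<kappa> * (1 - cmod b')"
      using z(3)[OF b(1)] z(3)[OF b(2)] by linarith
    moreover have lower: "2 * \<kappa> * (1 - cmod u) \<le> cmod (u - v)" if "u \<in> B" "v \<in> B" "u \<noteq> v" for u v
      using mult_right_mono[OF sep[OF that], of "1 - cmod u"] pseudohyp_dist_le[of u v]
        B1[OF that(1)] B1[OF that(2)] by linarith
    ultimately show False
      using lower[OF b(1,2,4)] lower[OF b(2,1) b(4)[symmetric]] norm_minus_commute[of b b']
      by linarith
  qed
  define J where "J = - 8 * ln (cmod (f a)) / (1 - (cmod a)\<^sup>2)"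
  have "(\<Sum>b\<in>F. 1 - cmod b) \<le> 2 * J" if F: "F \<subseteq> B" "finite F" for F
  proof -
    have "(\<Sum>b\<in>F. 1 - cmod b) \<le> (\<Sum>b\<in>F. 2 * (1 - cmod (z b)))"
    proof (rule sum_mono)
      fix b assume "b \<in> F"
      then have b: "b \<in> B"
        using F by blast
      have "cmod (z b) \<le> cmod b + cmod (b - z b)"
        using norm_triangle_ineq4[of b "b - z b"] by simp
      moreover have "\<kappa> * (1 - cmod b) \<le> 1 / 2 * (1 - cmod b)"
        using \<kappa> B1[OF b] by (intro mult_right_mono) auto
      ultimately show "1 - cmod b \<le> 2 * (1 - cmod (z b))"
        using z(3)[OF b] by (simp add: algebra_simps)
    qed
    also have "\<dots> = 2 * (\<Sum>y\<in>z ` F. 1 - cmod y)"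
      using inj_on_subset[OF inj F(1)] by (simp add: sum.reindex sum_distrib_left)
    also have "\<dots> \<le> 2 * J"
      unfolding J_def using F z by (intro mult_left_mono finite_zeros_sum_le[OF hol le a]) auto
    finally show ?thesis .
  qed
  then have "bdd_above (sum (\<lambda>z. 1 - cmod z) ` {F. F \<subseteq> B \<and> finite F})"
    by (intro bdd_aboveI[of _ "2 * J"]) auto
  then have "(\<lambda>z. 1 - cmod z) summable_on B"
    using B1 by (intro nonneg_bdd_above_summable_on) (auto simp: less_imp_le)
  then show ?thesis
    using B by (simp add: blaschke_def)
qed

lemma H_infty_contractive:
  assumes "f \<in> H_infty" "a \<in> ball 0 1" "f a \<noteq> 0"
  obtains g where "g holomorphic_on ball 0 1" "\<And>z. z \<in> ball 0 1 \<Longrightarrow> cmod (g z) \<le> 1"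
    "g a \<noteq> 0" "\<And>z. cmod (g z) \<le> cmod (f z)"
proof -
  obtain M where M: "\<And>z. z \<in> ball 0 1 \<Longrightarrow> cmod (f z) \<le> M"
    using assms(1) unfolding H_infty_def bounded_iff by blast
  \<comment> \<open>N \<ge> 1, so dividing by it never increases the modulus and the smallness of
    \<open>f\<close> is inherited.\<close>
  define N where "N = max M 1"
  have N: "1 \<le> N" "\<And>z. z \<in> ball 0 1 \<Longrightarrow> cmod (f z) \<le> N"
    using M by (force simp: N_def)+
  show thesis
  proof (rule that[of "\<lambda>z. f z / of_real N"])
    show "(\<lambda>z. f z / of_real N) holomorphic_on ball 0 1"
      using assms(1) N(1) unfolding H_infty_def by (intro holomorphic_intros) auto
    show "cmod (f z / of_real N) \<le> 1" if "z \<in> ball 0 1" for z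
      using N(1) N(2)[OF that] by (simp add: norm_divide)
    show "f a / of_real N \<noteq> 0"
      using assms(3) N(1) by simp
    fix z
    have "cmod (f z) * 1 \<le> cmod (f z) * N"
      using N(1) by (intro mult_left_mono) auto
    then show "cmod (f z / of_real N) \<le> cmod (f z)"
      using N(1) by (simp add: norm_divide pos_divide_le_eq)
  qed
qed

lemma decomposition_of_small_function:
  assumes \<Lambda>: "\<Lambda> \<subseteq> ball 0 1" "separated \<Lambda>"
    and hol: "f holomorphic_on ball 0 1" and le: "\<And>z. z \<in> ball 0 1 \<Longrightarrow> cmod (f z) \<le> 1"
    and a: "a \<in> ball 0 1" "f a \<noteq> 0" and small: "\<And>z. z \<in> \<Lambda> \<Longrightarrow> cmod (f z) < \<epsilon> z"
  shows "\<exists>B \<Gamma>. \<Lambda> = B \<union> \<Gamma> \<and> blaschke B \<and> poisson_dominated \<epsilon> \<Gamma>"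
proof -
  obtain \<delta> where \<delta>: "0 < \<delta>"
    "\<And>z w. z \<in> \<Lambda> \<Longrightarrow> w \<in> \<Lambda> \<Longrightarrow> z \<noteq> w \<Longrightarrow> \<delta> \<le> pseudohyp_dist z w"
    using separatedE[OF \<Lambda>(2)] by blast
  \<comment> \<open>\<delta> / 2 makes the assignment of zeros injective; 1/2 keeps the weight of a
    zero comparable with that of its point.\<close>
  define \<kappa> where "\<kappa> = min (1 / 2) (\<delta> / 2)"
  have \<kappa>: "0 < \<kappa>" "\<kappa> \<le> 1 / 2" "2 * \<kappa> \<le> \<delta>"
    using \<delta>(1) by (auto simp: \<kappa>_def)
  define B where "B = {b \<in> \<Lambda>. \<exists>z\<in>ball 0 1. f z = 0 \<and> cmod (b - z) < \<kappa> * (1 - cmod b)}"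
  have a1: "cmod a < 1"
    using a by simp
  have "blaschke B"
  proof (rule blaschke_near_zeros[OF hol le a1 a(2) _ \<kappa>(2)])
    show "2 * \<kappa> \<le> pseudohyp_dist z w" if "z \<in> B" "w \<in> B" "z \<noteq> w" for z w
      using \<delta>(2)[of z w] that \<kappa>(3) by (auto simp: B_def)
  qed (use \<Lambda> in \<open>auto simp: B_def\<close>)
  moreover have "poisson_dominated \<epsilon> (\<Lambda> - B)"
  proof (rule poisson_dominatedI)
    fix F c S
    assume F: "finite F" "F \<subseteq> \<Lambda> - B" and c: "\<And>\<gamma>. \<gamma> \<in> F \<Longrightarrow> (0::real) \<le> c \<gamma>"
      and S: "\<And>\<zeta>. cmod \<zeta> = 1 \<Longrightarrow> (\<Sum>\<gamma>\<in>F. c \<gamma> * poisson_kernel \<gamma> \<zeta>) \<le> S"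
    have F1: "F \<subseteq> ball 0 1"
      using F \<Lambda> by blast
    have far: "\<kappa> * (1 - cmod \<gamma>) \<le> cmod (\<gamma> - z)" if "\<gamma> \<in> F" "z \<in> ball 0 1" "f z = 0" for \<gamma> z
      using that F(2) unfolding B_def by force
    have "(\<Sum>\<gamma>\<in>F. c \<gamma> * ln (inverse (\<epsilon> \<gamma>))) \<le> (\<Sum>\<gamma>\<in>F. c \<gamma> * - ln (cmod (f \<gamma>)))"
    proof (intro sum_mono mult_left_mono c)
      fix \<gamma> assume \<gamma>: "\<gamma> \<in> F"
      then have g1: "\<gamma> \<in> ball 0 1"
        using F1 by blast
      then have "0 < \<kappa> * (1 - cmod \<gamma>)"
        using \<kappa> by simp
      then have "0 < cmod (f \<gamma>)"
        using far[OF \<gamma> g1] by auto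
      moreover have "cmod (f \<gamma>) < \<epsilon> \<gamma>"
        using small \<gamma> F by auto
      ultimately have "ln (cmod (f \<gamma>)) \<le> ln (\<epsilon> \<gamma>)" "0 < \<epsilon> \<gamma>"
        by (simp_all only: ln_mono less_imp_le less_trans)
      then show "ln (inverse (\<epsilon> \<gamma>)) \<le> - ln (cmod (f \<gamma>))"
        by (simp add: ln_inverse)
    qed
    also have "\<dots> \<le> (4 * ((\<kappa> + 8) / \<kappa>)\<^sup>2 * (- 8 * ln (cmod (f a)) / (1 - (cmod a)\<^sup>2)) +
        (1 + cmod a) / (1 - cmod a) * - ln (cmod (f a) / 2)) * S"
      using \<kappa> by (intro log_sum_le[OF hol le a1 a(2) _ _ F(1) F1 far c S]) auto
    finally show "(\<Sum>\<gamma>\<in>F. c \<gamma> * ln (inverse (\<epsilon> \<gamma>))) \<le>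
        (4 * ((\<kappa> + 8) / \<kappa>)\<^sup>2 * (- 8 * ln (cmod (f a)) / (1 - (cmod a)\<^sup>2)) +
        (1 + cmod a) / (1 - cmod a) * - ln (cmod (f a) / 2)) * S" .
  qed (use \<Lambda> in blast)
  moreover have "\<Lambda> = B \<union> (\<Lambda> - B)"
    by (auto simp: B_def)
  ultimately show ?thesis
    by blast
qed

theorem corollary1p5:
  fixes \<Lambda> :: "complex set" and \<epsilon> :: "complex \<Rightarrow> real"
  assumes "\<Lambda> \<subseteq> ball 0 1"
    and "separated \<Lambda>"
    and "\<not> blaschke \<Lambda>"
    and "\<And>z. z \<in> \<Lambda> \<Longrightarrow> 0 < \<epsilon> z"
  shows "(\<exists>f\<in>H_infty. (\<exists>z\<in>ball 0 1. f z \<noteq> 0) \<and> (\<forall>z\<in>\<Lambda>. cmod (f z) < \<epsilon> z)) \<longleftrightarrow>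
         (\<exists>B \<Gamma>. \<Lambda> = B \<union> \<Gamma> \<and> blaschke B \<and> poisson_dominated \<epsilon> \<Gamma>)"
proof
  assume "\<exists>f\<in>H_infty. (\<exists>z\<in>ball 0 1. f z \<noteq> 0) \<and> (\<forall>z\<in>\<Lambda>. cmod (f z) < \<epsilon> z)"
  then obtain f a where f: "f \<in> H_infty" "a \<in> ball 0 1" "f a \<noteq> 0" "\<forall>z\<in>\<Lambda>. cmod (f z) < \<epsilon> z"
    by blast
  obtain g where g: "g holomorphic_on ball 0 1" "\<And>z. z \<in> ball 0 1 \<Longrightarrow> cmod (g z) \<le> 1"
    "g a \<noteq> 0" "\<And>z. cmod (g z) \<le> cmod (f z)"
    using H_infty_contractive[OF f(1-3)] by blast
  have "cmod (g z) < \<epsilon> z" if "z \<in> \<Lambda>" for z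
    using f(4) g(4)[of z] that by force
  then show "\<exists>B \<Gamma>. \<Lambda> = B \<union> \<Gamma> \<and> blaschke B \<and> poisson_dominated \<epsilon> \<Gamma>"
    by (intro decomposition_of_small_function[OF assms(1,2) g(1,2) f(2) g(3)])
next
  assume "\<exists>B \<Gamma>. \<Lambda> = B \<union> \<Gamma> \<and> blaschke B \<and> poisson_dominated \<epsilon> \<Gamma>"
  then obtain B \<Gamma> where B: "\<Lambda> = B \<union> \<Gamma>" "blaschke B" "poisson_dominated \<epsilon> \<Gamma>"
    by blast
  have "countable \<Gamma>"
    using separated_imp_countable[OF assms(1,2)] B(1) by simp
  then show "\<exists>f\<in>H_infty. (\<exists>z\<in>ball 0 1. f z \<noteq> 0) \<and> (\<forall>z\<in>\<Lambda>. cmod (f z) < \<epsilon> z)"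
    using small_function_of_poisson_dominated[of \<Gamma> B \<epsilon>] assms(1,4) B by simp
qed

end
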